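(* Let $P$ be a finite poset, $\ell$ a positive integer, $u,v$ as in the context, and $R$ a restriction function on $P$ that is consistent with respect to $P\times[\ell]^v_u$. Then the map $\Phi$ defined in the context is a bijection from $\mathcal L_{P\times[\ell]}(u,v,R)$ onto $\mathcal A^{\hat B}(\Gamma(P,\hat R))$, and for every $f\in\mathcal L_{P\times[\ell]}(u,v,R)$, $$\Phi(\mathrm{Pro}(f))=\mathrm{TogPro}(\Phi(f)).$$
   Context: $P\times[\ell]=\{(p,i):p\in P,1\le i\le\ell\}$ with product order. $u,v:P\to\{0,\ldots,\ell\}$ satisfy $u(p)+v(p)\le\ell$, and $v(p_1)\le v(p_2)$, $u(p_1)\ge u(p_2)$ whenever $p_1\le_Pp_2$; $P\times[\ell]^v_u=\{(p,i): u(p)<i<\ell+1-v(p)\}$. The fiber of $p$ is $F_p=\{(p,i)\in P\times[\ell]^v_u\}$. A restriction function is a map $R$ from $P$ to nonempty finite subsets of $\mathbb Z$. A $P$-strict labeling with restriction $R$ is $f:P\times[\ell]^v_u\to\mathbb Z$ with $f(p_1,i)<f(p_2,i)$ whenever $p_1<_Pp_2$, $f(p,i_1)\le f(p,i_2)$ whenever $i_1\le i_2$, and $f(p,i)\in R(p)$; the set of these is $\mathcal L_{P\times[\ell]}(u,v,R)$. $R$ is consistent w.r.t. $P\times[\ell]^v_u$ if every $k\in R(p)$ equals $f(p,i)$ for some such $f$ and some $(p,i)\in P\times[\ell]^v_u$. $R(p)_{>k}$ (resp. $R(p)_{<k}$) is the smallest element of $R(p)$ greater than $k$ (resp. largest less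 than $k$). A label $f(p,i)$ is raisable (resp. lowerable) if there is $g\in\mathcal L_{P\times[\ell]}(u,v,R)$ with $g(p,i)>f(p,i)$ (resp. $<$) and $g(p',i')=f(p',i')$ for all $(p',i')\in P\times[\ell]^v_u$ with $p'\ne p$. The Bender–Knuth involution $\rho_k$ acts fiberwise: if $k\notin R(p)$ or $k=\max R(p)$, $F_p$ is unchanged; otherwise call free the raisable labels equal to $k$ and the lowerable labels equal to $R(p)_{>k}$ in $F_p$; if these read (in increasing $i$) $a$ copies of $k$ followed by $b$ copies of $R(p)_{>k}$, replace them by $b$ copies of $k$ followed by $a$ copies of $R(p)_{>k}$. Promotion is $\mathrm{Pro}=\cdots\circ\rho_2\circ\rho_1\circ\rho_0\circ\rho_{-1}\circ\cdots$ (only finitely many $\rho_k$ act nontrivially). $\Gamma$: for a restriction function $R'$, let $R'(p)^*=R'(p)\setminus\{\max R'(p)\}$. $\Gamma(P,R')$ is the poset on $\{(p,k):p\in P,k\in R'(p)^*\}$ whose covering relations are $(p_1,k_1)\lessdot(p_2,k_2)$ iff either (1) $p_1=p_2$ and $k_1=R'(p_1)_{>k_2}$, or (2) $p_1\lessdot_Pp_2$, $k_1=R'(p_1)_{<k_2}\ne\max R'(p_1)$, and there is no $k\in R'(p_2)$ with $k>k_2$ and $R'(p_1)_{<k}=k_1$. $\hat R$: with $h(p)$ (resp. $\tilde h(p)$) the maximum number of elements of a chain of $P$ with largest (resp. smallest) element $p$, $\hat R(p)=R(p)\cup\{\min\bigcup_{q}R(q)-\tilde h(p),\ \max\bigcup_qR(q)+h(p)\}$.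 $Q$-partitions: for a finite poset $Q$, $W\subseteq Q$ containing all minimal and maximal elements of $Q$, and order-preserving $B:W\to\{0,\ldots,\ell\}$, $\mathcal A^B(Q)$ is the set of order-preserving $\sigma:Q\to\{0,\ldots,\ell\}$ with $\sigma|_W=B$; $W=\mathrm{dom}(B)$. For $x\in Q\setminus W$ the toggle $\tau_x$ changes only the value at $x$, to $\min\{\sigma(y):y\text{ covers }x\}+\max\{\sigma(z):z\text{ is covered by }x\}-\sigma(x)$. Here $\hat B$ has domain $\{(p,\min\hat R(p)^* ),(p,\max\hat R(p)^* ):p\in P\}$ in $\Gamma(P,\hat R)$, with $\hat B(p,\min\hat R(p)^* )=\ell-u(p)$ and $\hat B(p,\max\hat R(p)^* )=v(p)$. $\mathrm{TogPro}=\cdots\circ\tau_2\circ\tau_1\circ\tau_0\circ\tau_{-1}\circ\cdots$ on $\mathcal A^{\hat B}(\Gamma(P,\hat R))$, where $\tau_k$ is the composition of the (pairwise commuting) toggles $\tau_{(p,k)}$ over all $p$ with $(p,k)\in\Gamma(P,\hat R)\setminus\mathrm{dom}(\hat B)$. $\Phi$: for $f\in\mathcal L_{P\times[\ell]}(u,v,R)$ define $\hat f$ on all of $P\times[\ell]$ by $\hat f(p,i)=\min\hat R(p)$ if $i\le u(p)$, $\hat f(p,i)=f(p,i)$ if $u(p)<i<\ell+1-v(p)$, $\hat f(p,i)=\max\hat R(p)$ if $i\ge\ell+1-v(p)$. For each $i$ let $\mathcal O_i=\{(p,k)\in\Gamma(P,\hat R): k\ge\hat f(p,i)\}$, an order ideal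 of $\Gamma(P,\hat R)$. Then $\Phi(f)(p,k)$ is the number of $i\in\{1,\ldots,\ell\}$ with $(p,k)\notin\mathcal O_i$, i.e. $\Phi(f)(p,k)=\#\{i\in\{1,\ldots,\ell\}:\hat f(p,i)>k\}$. *)

theory Defs
  imports Complex_Main "HOL-Library.FuncSet"
begin

text \<open>
  A poset is a carrier set together with a relation satisfying \<^const>\<open>partial_order_on\<close>.
  Functions defined on a set of pairs are extensional
  (equal to \<^const>\<open>undefined\<close> off that set), so that equality and bijectivity mean the right thing.
\<close>

definition covers :: "'b rel \<Rightarrow> 'b \<Rightarrow> 'b \<Rightarrow> bool" where
  "covers r x y \<longleftrightarrow> (x, y) \<in> r \<and> x \<noteq> y \<and>
     \<not> (\<exists>z. (x, z) \<in> r \<and> (z, y) \<in> r \<and> z \<noteq> x \<and> z \<noteq> y)"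

text \<open>\<open>covers r x y\<close> reads: \<open>y\<close> covers \<open>x\<close>.\<close>

definition next_above :: "int set \<Rightarrow> int \<Rightarrow> int" where
  "next_above A k = Min {x \<in> A. x > k}"

definition next_below :: "int set \<Rightarrow> int \<Rightarrow> int" where
  "next_below A k = Max {x \<in> A. x < k}"

text \<open>
  The composition \<open>\<cdots> \<circ> F 1 \<circ> F 0 \<circ> F (-1) \<circ> \<cdots>\<close> of a family of maps indexed by the integers:
  the eventual value of the finite compositions \<open>F N \<circ> \<cdots> \<circ> F (-N)\<close>.
  It exists whenever all but finitely many \<open>F k\<close> are the identity.
\<close>

definition int_composition :: "(int \<Rightarrow> 's \<Rightarrow> 's) \<Rightarrow> 's \<Rightarrow> 's" where
  "int_composition F x =
     (THE y. \<forall>\<^sub>F N in sequentially. fold F [- int N..int N] x = y)"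

section \<open>\<open>P\<close>-strict labelings and promotion\<close>

definition skew_domain :: "'a set \<Rightarrow> nat \<Rightarrow> ('a \<Rightarrow> nat) \<Rightarrow> ('a \<Rightarrow> nat) \<Rightarrow> ('a \<times> nat) set" where
  "skew_domain P l u v =
     {(p, i). p \<in> P \<and> i \<in> {1..l} \<and> u p < i \<and> i < l + 1 - v p}"

definition restriction_function :: "'a set \<Rightarrow> ('a \<Rightarrow> int set) \<Rightarrow> bool" where
  "restriction_function P R \<longleftrightarrow> (\<forall>p\<in>P. finite (R p) \<and> R p \<noteq> {})"

definition strict_labelings ::
  "'a set \<Rightarrow> 'a rel \<Rightarrow> nat \<Rightarrow> ('a \<Rightarrow> nat) \<Rightarrow> ('a \<Rightarrow> nat) \<Rightarrow> ('a \<Rightarrow> int set) \<Rightarrow> ('a \<times> nat \<Rightarrow> int) set"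
  where
  "strict_labelings P r l u v R =
     {f \<in> (\<Pi>\<^sub>E (p, i)\<in>skew_domain P l u v. R p).
        (\<forall>p q i. (p, i) \<in> skew_domain P l u v \<longrightarrow> (q, i) \<in> skew_domain P l u v \<longrightarrow>
            (p, q) \<in> r \<longrightarrow> p \<noteq> q \<longrightarrow> f (p, i) < f (q, i)) \<and>
        (\<forall>p i j. (p, i) \<in> skew_domain P l u v \<longrightarrow> (p, j) \<in> skew_domain P l u v \<longrightarrow>
            i \<le> j \<longrightarrow> f (p, i) \<le> f (p, j))}"

definition consistent ::
  "'a set \<Rightarrow> 'a rel \<Rightarrow> nat \<Rightarrow> ('a \<Rightarrow> nat) \<Rightarrow> ('a \<Rightarrow> nat) \<Rightarrow> ('a \<Rightarrow> int set) \<Rightarrow> bool" where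
  "consistent P r l u v R \<longleftrightarrow>
     (\<forall>p\<in>P. \<forall>k\<in>R p. \<exists>f\<in>strict_labelings P r l u v R. \<exists>i.
        (p, i) \<in> skew_domain P l u v \<and> f (p, i) = k)"

definition raisable ::
  "'a set \<Rightarrow> 'a rel \<Rightarrow> nat \<Rightarrow> ('a \<Rightarrow> nat) \<Rightarrow> ('a \<Rightarrow> nat) \<Rightarrow> ('a \<Rightarrow> int set) \<Rightarrow>
   ('a \<times> nat \<Rightarrow> int) \<Rightarrow> 'a \<Rightarrow> nat \<Rightarrow> bool" where
  "raisable P r l u v R f p i \<longleftrightarrow>
     (\<exists>g\<in>strict_labelings P r l u v R. g (p, i) > f (p, i) \<and>
        (\<forall>(p', i')\<in>skew_domain P l u v. p' \<noteq> p \<longrightarrow> g (p', i') = f (p', i')))"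

definition lowerable ::
  "'a set \<Rightarrow> 'a rel \<Rightarrow> nat \<Rightarrow> ('a \<Rightarrow> nat) \<Rightarrow> ('a \<Rightarrow> nat) \<Rightarrow> ('a \<Rightarrow> int set) \<Rightarrow>
   ('a \<times> nat \<Rightarrow> int) \<Rightarrow> 'a \<Rightarrow> nat \<Rightarrow> bool" where
  "lowerable P r l u v R f p i \<longleftrightarrow>
     (\<exists>g\<in>strict_labelings P r l u v R. g (p, i) < f (p, i) \<and>
        (\<forall>(p', i')\<in>skew_domain P l u v. p' \<noteq> p \<longrightarrow> g (p', i') = f (p', i')))"

text \<open>Positions in the fiber of \<open>p\<close> of the raisable labels \<open>k\<close>, resp. of the lowerable labels
  \<open>next_above (R p) k\<close>.\<close>

definition free_low ::
  "'a set \<Rightarrow> 'a rel \<Rightarrow> nat \<Rightarrow> ('a \<Rightarrow> nat) \<Rightarrow> ('a \<Rightarrow> nat) \<Rightarrow> ('a \<Rightarrow> int set) \<Rightarrow>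
   int \<Rightarrow> ('a \<times> nat \<Rightarrow> int) \<Rightarrow> 'a \<Rightarrow> nat set" where
  "free_low P r l u v R k f p =
     {i. (p, i) \<in> skew_domain P l u v \<and> f (p, i) = k \<and> raisable P r l u v R f p i}"

definition free_high ::
  "'a set \<Rightarrow> 'a rel \<Rightarrow> nat \<Rightarrow> ('a \<Rightarrow> nat) \<Rightarrow> ('a \<Rightarrow> nat) \<Rightarrow> ('a \<Rightarrow> int set) \<Rightarrow>
   int \<Rightarrow> ('a \<times> nat \<Rightarrow> int) \<Rightarrow> 'a \<Rightarrow> nat set" where
  "free_high P r l u v R k f p =
     {i. (p, i) \<in> skew_domain P l u v \<and> f (p, i) = next_above (R p) k \<and>
         lowerable P r l u v R f p i}"

text \<open>
  All fibers are changed simultaneously. With \<open>b = card (free_high \<dots>)\<close>, the first \<open>b\<close> free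
  positions of a fiber (in increasing \<open>i\<close>) receive \<open>k\<close> and the remaining ones
  \<open>next_above (R p) k\<close>.
\<close>

definition bender_knuth ::
  "'a set \<Rightarrow> 'a rel \<Rightarrow> nat \<Rightarrow> ('a \<Rightarrow> nat) \<Rightarrow> ('a \<Rightarrow> nat) \<Rightarrow> ('a \<Rightarrow> int set) \<Rightarrow>
   int \<Rightarrow> ('a \<times> nat \<Rightarrow> int) \<Rightarrow> ('a \<times> nat \<Rightarrow> int)" where
  "bender_knuth P r l u v R k f = (\<lambda>(p, i)\<in>skew_domain P l u v.
     let free = free_low P r l u v R k f p \<union> free_high P r l u v R k f p;
         b = card (free_high P r l u v R k f p)
     in if k \<notin> R p \<or> k = Max (R p) \<or> i \<notin> free then f (p, i)
        else if card {j \<in> free. j < i} < b then k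
        else next_above (R p) k)"

definition promotion ::
  "'a set \<Rightarrow> 'a rel \<Rightarrow> nat \<Rightarrow> ('a \<Rightarrow> nat) \<Rightarrow> ('a \<Rightarrow> nat) \<Rightarrow> ('a \<Rightarrow> int set) \<Rightarrow>
   ('a \<times> nat \<Rightarrow> int) \<Rightarrow> ('a \<times> nat \<Rightarrow> int)" where
  "promotion P r l u v R = int_composition (bender_knuth P r l u v R)"

section \<open>The poset \<open>\<Gamma>(P, R)\<close>\<close>

definition star :: "int set \<Rightarrow> int set" where
  "star A = A - {Max A}"

definition gamma :: "'a set \<Rightarrow> ('a \<Rightarrow> int set) \<Rightarrow> ('a \<times> int) set" where
  "gamma P R = (SIGMA p:P. star (R p))"

text \<open>
  In the second clause the condition \<open>{x \<in> R p\<^sub>1. x < k\<^sub>2} \<noteq> {}\<close> says that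
  \<open>next_below (R p\<^sub>1) k\<^sub>2\<close> exists; \<open>next_below (R p\<^sub>1) k\<close> then exists for all \<open>k > k\<^sub>2\<close>. In the first
  clause \<open>next_above (R p\<^sub>1) k\<^sub>2\<close> exists because \<open>k\<^sub>2\<close> is not the maximum of \<open>R p\<^sub>1\<close>.
\<close>

definition gamma_covers :: "'a set \<Rightarrow> 'a rel \<Rightarrow> ('a \<Rightarrow> int set) \<Rightarrow> ('a \<times> int) rel" where
  "gamma_covers P r R =
     {((p\<^sub>1, k\<^sub>1), (p\<^sub>2, k\<^sub>2)).
        (p\<^sub>1, k\<^sub>1) \<in> gamma P R \<and> (p\<^sub>2, k\<^sub>2) \<in> gamma P R \<and>
        ((p\<^sub>1 = p\<^sub>2 \<and> k\<^sub>1 = next_above (R p\<^sub>1) k\<^sub>2) \<or>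
         (covers r p\<^sub>1 p\<^sub>2 \<and> {x \<in> R p\<^sub>1. x < k\<^sub>2} \<noteq> {} \<and>
          k\<^sub>1 = next_below (R p\<^sub>1) k\<^sub>2 \<and> k\<^sub>1 \<noteq> Max (R p\<^sub>1) \<and>
          \<not> (\<exists>k\<in>R p\<^sub>2. k > k\<^sub>2 \<and> next_below (R p\<^sub>1) k = k\<^sub>1)))}"

definition gamma_order :: "'a set \<Rightarrow> 'a rel \<Rightarrow> ('a \<Rightarrow> int set) \<Rightarrow> ('a \<times> int) rel" where
  "gamma_order P r R = Id_on (gamma P R) \<union> (gamma_covers P r R)\<^sup>+"

lemma gamma_covers_memb:
  assumes "((p, k), (q, m)) \<in> gamma_covers P r R"
  shows "p \<in> P" "k \<in> R p" "q \<in> P" "m \<in> R q" "m \<noteq> Max (R q)"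
  using assms by (auto simp: gamma_covers_def gamma_def star_def)

lemma gamma_covers_same:
  assumes "restriction_function P R" and c: "((p, k), (p, m)) \<in> gamma_covers P r R"
  shows "m < k" "\<And>x. x \<in> R p \<Longrightarrow> m < x \<Longrightarrow> k \<le> x"
proof -
  note mem = gamma_covers_memb[OF c]
  have fin: "finite (R p)" using assms mem by (auto simp: restriction_function_def)
  have "m < Max (R p)" using mem fin by (meson Max_ge order_le_imp_less_or_eq)
  then have ne: "{x \<in> R p. m < x} \<noteq> {}" using mem fin by (metis (mono_tags, lifting) Max_in empty_iff mem_Collect_eq)
  have k: "k = Min {x \<in> R p. m < x}"
    using c by (auto simp: gamma_covers_def next_above_def covers_def)
  show "m < k" using Min_in[OF _ ne] fin k by auto
  show "\<And>x. x \<in> R p \<Longrightarrow> m < x \<Longrightarrow> k \<le> x" using fin k by auto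
qed

lemma gamma_covers_diff:
  assumes "restriction_function P R" and c: "((p, k), (q, m)) \<in> gamma_covers P r R" and "p \<noteq> q"
  shows "covers r p q" "k < m" "\<And>x. x \<in> R p \<Longrightarrow> x < m \<Longrightarrow> x \<le> k" "k = next_below (R p) m"
    "\<And>x. x \<in> R q \<Longrightarrow> m < x \<Longrightarrow> next_below (R p) x \<noteq> k"
proof -
  note mem = gamma_covers_memb[OF c]
  have fin: "finite (R p)" using assms mem by (auto simp: restriction_function_def)
  have *: "covers r p q" "{x \<in> R p. x < m} \<noteq> {}" "k = next_below (R p) m"
     "\<And>x. x \<in> R q \<Longrightarrow> m < x \<Longrightarrow> next_below (R p) x \<noteq> k"
    using c \<open>p \<noteq> q\<close> by (auto simp: gamma_covers_def)
  show "covers r p q" "k = next_below (R p) m"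
    "\<And>x. x \<in> R q \<Longrightarrow> m < x \<Longrightarrow> next_below (R p) x \<noteq> k" by (fact *)+
  show "k < m" using Max_in[OF _ *(2)] fin *(3) by (auto simp: next_below_def)
  show "\<And>x. x \<in> R p \<Longrightarrow> x < m \<Longrightarrow> x \<le> k" using fin *(3) by (auto simp: next_below_def)
qed

lemma gamma_trancl_order:
  assumes po: "partial_order_on P r" and R: "restriction_function P R"
    and c: "(x, y) \<in> (gamma_covers P r R)\<^sup>+"
  shows "x \<in> gamma P R \<and> y \<in> gamma P R \<and> (fst x, fst y) \<in> r \<and> (fst x = fst y \<longrightarrow> snd y < snd x)"
proof -
  have tr: "trans r" and an: "antisym r" and rf: "\<And>p. p \<in> P \<Longrightarrow> (p, p) \<in> r"
    using partial_order_onD[OF po] by (auto simp: refl_on_def)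
  have one: "y \<in> gamma P R \<and> z \<in> gamma P R \<and> (fst y, fst z) \<in> r \<and> (fst y = fst z \<longrightarrow> snd z < snd y)"
    if yz: "(y, z) \<in> gamma_covers P r R" for y z
  proof -
    have g: "y \<in> gamma P R" "z \<in> gamma P R" using yz by (auto simp: gamma_covers_def)
    then have P: "fst y \<in> P" by (auto simp: gamma_def)
    have yz': "((fst y, snd y), (fst z, snd z)) \<in> gamma_covers P r R" using yz by simp
    show ?thesis
    proof (cases "fst y = fst z")
      case True
      then show ?thesis using gamma_covers_same(1)[OF R, of "fst y" "snd y" "snd z" r] yz' g rf[OF P]
        by simp
    next
      case False
      then show ?thesis using gamma_covers_diff(1)[OF R yz' False] g by (simp add: covers_def)
    qed
  qed
  from c show ?thesis
  proof (induction rule: trancl_induct)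
    case (base y)
    then show ?case by (rule one)
  next
    case (step y z)
    show ?case using step.IH one[OF step.hyps(2)] tr an
      by (metis antisymD transD less_trans)
  qed
qed

lemma gamma_trancl_crossing:
  assumes po: "partial_order_on P r" and R: "restriction_function P R"
    and c: "(x, y) \<in> (gamma_covers P r R)\<^sup>+" and "covers r (fst x) (fst y)"
  shows "\<exists>a b. a \<le> snd x \<and> snd y \<le> b \<and> ((fst x, a), (fst y, b)) \<in> gamma_covers P r R"
  using c assms(4)
proof (induction rule: trancl_induct)
  case (base y)
  then show ?case by (metis order_refl prod.collapse)
next
  case (step y z)
  have yz: "(fst y, fst z) \<in> r" "fst y = fst z \<longrightarrow> snd z < snd y"
    and xy: "(fst x, fst y) \<in> r" "fst x = fst y \<longrightarrow> snd y < snd x"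
    using gamma_trancl_order[OF po R] step.hyps by blast+
  show ?case
  proof (cases "fst y = fst z")
    case True
    then obtain a b where "a \<le> snd x" "snd y \<le> b" "((fst x, a), (fst y, b)) \<in> gamma_covers P r R"
      using step by auto
    then show ?thesis using True yz by (metis less_le_not_le order_trans)
  next
    case False
    then have "fst y = fst x" using step.prems xy yz unfolding covers_def by metis
    then show ?thesis using step.hyps(2) xy by (metis less_imp_le order_refl prod.collapse)
  qed
qed

lemma partial_order_on_gamma:
  assumes "partial_order_on P r" and "restriction_function P R"
  shows "partial_order_on (gamma P R) (gamma_order P r R)"
proof -
  note o = gamma_trancl_order[OF assms]
  have an: "antisym r" using partial_order_onD[OF assms(1)] by auto
  have nc: False if "(x, y) \<in> (gamma_covers P r R)\<^sup>+" "(y, x) \<in> (gamma_covers P r R)\<^sup>+" for x y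
    using o[OF trancl_trans[OF that]] by simp
  show ?thesis unfolding partial_order_on_def preorder_on_def
  proof (intro conjI)
    show "gamma_order P r R \<subseteq> gamma P R \<times> gamma P R"
      using o by (auto simp: gamma_order_def)
    show "refl_on (gamma P R) (gamma_order P r R)"
      by (auto simp: gamma_order_def refl_on_def)
    show "trans (gamma_order P r R)"
      unfolding gamma_order_def trans_def Id_on_def by (auto intro: trancl_trans)
    show "antisym (gamma_order P r R)"
      unfolding gamma_order_def antisym_def Id_on_def using nc by blast
  qed
qed

text \<open>The covering relations of \<^const>\<open>gamma_order\<close> are exactly the prescribed ones.\<close>

lemma covers_gamma_order:
  assumes po: "partial_order_on P r" and R: "restriction_function P R"
  shows "covers (gamma_order P r R) x y \<longleftrightarrow> (x, y) \<in> gamma_covers P r R"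
proof
  let ?C = "gamma_covers P r R"
  note o = gamma_trancl_order[OF po R]
  have irr: "(x, x) \<notin> ?C\<^sup>+" for x using o[of x x] by auto
  { assume "covers (gamma_order P r R) x y"
    then have xy: "(x, y) \<in> ?C\<^sup>+" and nz: "\<And>z. (x, z) \<in> ?C\<^sup>+ \<Longrightarrow> (z, y) \<in> ?C\<^sup>+ \<Longrightarrow> z = x \<or> z = y"
      by (auto simp: covers_def gamma_order_def)
    from xy show "(x, y) \<in> ?C"
    proof (cases rule: tranclE)
      case (step z)
      then show ?thesis using nz[OF step(1) r_into_trancl[OF step(2)]] irr r_into_trancl[OF step(2)]
        by metis
    qed }
  assume C: "(x, y) \<in> ?C"
  obtain p k q m where [simp]: "x = (p, k)" "y = (q, m)" by fastforce
  have no: False if xz: "(x, z) \<in> ?C\<^sup>+" and zy: "(z, y) \<in> ?C\<^sup>+" for z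
  proof -
    obtain s j where [simp]: "z = (s, j)" by fastforce
    have an: "antisym r" using partial_order_onD[OF po] by auto
    have ps: "(p, s) \<in> r" "p = s \<longrightarrow> j < k" and sq: "(s, q) \<in> r" "s = q \<longrightarrow> m < j"
      and j: "j \<in> R s" using o[OF xz] o[OF zy] by (auto simp: gamma_def star_def)
    show False
    proof (cases "p = q")
      case True
      then have "s = p" using ps sq an by (auto dest: antisymD)
      then show False using gamma_covers_same(2)[OF R, of p k m r j] C j ps sq True by auto
    next
      case False
      note d = gamma_covers_diff[OF R C[simplified] False]
      have "s = p \<or> s = q" using d(1) ps sq unfolding covers_def by blast
      then show False
      proof
        assume [simp]: "s = p"
        obtain a b where ab: "a \<le> j" "m \<le> b" "((p, a), (q, b)) \<in> ?C"
          using gamma_trancl_crossing[OF po R zy] d(1) by auto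
        have "k \<le> a" using gamma_covers_diff(3)[OF R ab(3) False, of k] d(2) ab
            gamma_covers_memb[OF C[simplified]] by auto
        then show False using ab ps by auto
      next
        assume [simp]: "s = q"
        obtain a b where ab: "a \<le> k" "j \<le> b" "((p, a), (q, b)) \<in> ?C"
          using gamma_trancl_crossing[OF po R xz] d(1) by auto
        have "k \<le> a" using gamma_covers_diff(3)[OF R ab(3) False, of k] d(2) ab sq
            gamma_covers_memb[OF C[simplified]] by auto
        then have "next_below (R p) b = k" using gamma_covers_diff(4)[OF R ab(3) False] ab by auto
        then show False using d(5)[of b] gamma_covers_memb[OF ab(3)] ab sq by auto
      qed
    qed
  qed
  have "x \<noteq> y" using irr C by blast
  then show "covers (gamma_order P r R) x y"
    using C no by (auto simp: covers_def gamma_order_def Id_on_def)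
qed

section \<open>\<open>Q\<close>-partitions and toggles\<close>

definition boundary_map :: "'b set \<Rightarrow> 'b rel \<Rightarrow> nat \<Rightarrow> ('b \<rightharpoonup> int) \<Rightarrow> bool" where
  "boundary_map Q r l B \<longleftrightarrow>
     dom B \<subseteq> Q \<and>
     {x \<in> Q. \<forall>y. (y, x) \<in> r \<longrightarrow> y = x} \<subseteq> dom B \<and>
     {x \<in> Q. \<forall>y. (x, y) \<in> r \<longrightarrow> y = x} \<subseteq> dom B \<and>
     ran B \<subseteq> {0..int l} \<and>
     monotone_on (dom B) (\<lambda>x y. (x, y) \<in> r) (\<le>) (\<lambda>x. the (B x))"

text \<open>
  The requirements on the boundary data are part of the definition: the set is empty
  unless \<open>boundary_map Q r l B\<close> holds.
\<close>

definition Q_partitions :: "'b set \<Rightarrow> 'b rel \<Rightarrow> nat \<Rightarrow> ('b \<rightharpoonup> int) \<Rightarrow> ('b \<Rightarrow> int) set" where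
  "Q_partitions Q r l B =
     {\<sigma> \<in> Q \<rightarrow>\<^sub>E {0..int l}. boundary_map Q r l B \<and>
        monotone_on Q (\<lambda>x y. (x, y) \<in> r) (\<le>) \<sigma> \<and> (\<forall>x\<in>dom B. B x = Some (\<sigma> x))}"

definition toggle :: "'b rel \<Rightarrow> 'b \<Rightarrow> ('b \<Rightarrow> int) \<Rightarrow> ('b \<Rightarrow> int)" where
  "toggle r x \<sigma> =
     \<sigma>(x := Min (\<sigma> ` {y. covers r x y}) + Max (\<sigma> ` {z. covers r z x}) - \<sigma> x)"

section \<open>Toggle-promotion and the map \<open>\<Phi>\<close>\<close>

definition height_below :: "'a set \<Rightarrow> 'a rel \<Rightarrow> 'a \<Rightarrow> nat" where
  "height_below P r p =
     Max (card ` {C. C \<subseteq> P \<and> C \<in> Chains r \<and> p \<in> C \<and> (\<forall>q\<in>C. (q, p) \<in> r)})"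

definition height_above :: "'a set \<Rightarrow> 'a rel \<Rightarrow> 'a \<Rightarrow> nat" where
  "height_above P r p =
     Max (card ` {C. C \<subseteq> P \<and> C \<in> Chains r \<and> p \<in> C \<and> (\<forall>q\<in>C. (p, q) \<in> r)})"

definition R_hat :: "'a set \<Rightarrow> 'a rel \<Rightarrow> ('a \<Rightarrow> int set) \<Rightarrow> 'a \<Rightarrow> int set" where
  "R_hat P r R p = R p \<union>
     {Min (\<Union>q\<in>P. R q) - int (height_above P r p),
      Max (\<Union>q\<in>P. R q) + int (height_below P r p)}"

definition B_hat ::
  "'a set \<Rightarrow> 'a rel \<Rightarrow> nat \<Rightarrow> ('a \<Rightarrow> nat) \<Rightarrow> ('a \<Rightarrow> nat) \<Rightarrow> ('a \<Rightarrow> int set) \<Rightarrow> ('a \<times> int \<rightharpoonup> int)" where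
  "B_hat P r l u v R = (\<lambda>(p, k).
     if p \<in> P \<and> k = Min (star (R_hat P r R p)) then Some (int l - int (u p))
     else if p \<in> P \<and> k = Max (star (R_hat P r R p)) then Some (int (v p))
     else None)"

text \<open>The toggles composed here commute pairwise, so \<^const>\<open>Finite_Set.fold\<close> is their composition
  in any order.\<close>

definition toggle_level ::
  "'a set \<Rightarrow> 'a rel \<Rightarrow> nat \<Rightarrow> ('a \<Rightarrow> nat) \<Rightarrow> ('a \<Rightarrow> nat) \<Rightarrow> ('a \<Rightarrow> int set) \<Rightarrow>
   int \<Rightarrow> ('a \<times> int \<Rightarrow> int) \<Rightarrow> ('a \<times> int \<Rightarrow> int)" where
  "toggle_level P r l u v R k \<sigma> =
     Finite_Set.fold (\<lambda>p. toggle (gamma_order P r (R_hat P r R)) (p, k)) \<sigma>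
       {p. (p, k) \<in> gamma P (R_hat P r R) - dom (B_hat P r l u v R)}"

definition toggle_promotion ::
  "'a set \<Rightarrow> 'a rel \<Rightarrow> nat \<Rightarrow> ('a \<Rightarrow> nat) \<Rightarrow> ('a \<Rightarrow> nat) \<Rightarrow> ('a \<Rightarrow> int set) \<Rightarrow>
   ('a \<times> int \<Rightarrow> int) \<Rightarrow> ('a \<times> int \<Rightarrow> int)" where
  "toggle_promotion P r l u v R = int_composition (toggle_level P r l u v R)"

definition f_hat ::
  "'a set \<Rightarrow> 'a rel \<Rightarrow> nat \<Rightarrow> ('a \<Rightarrow> nat) \<Rightarrow> ('a \<Rightarrow> nat) \<Rightarrow> ('a \<Rightarrow> int set) \<Rightarrow>
   ('a \<times> nat \<Rightarrow> int) \<Rightarrow> 'a \<Rightarrow> nat \<Rightarrow> int" where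
  "f_hat P r l u v R f p i =
     (if i \<le> u p then Min (R_hat P r R p)
      else if i < l + 1 - v p then f (p, i)
      else Max (R_hat P r R p))"

definition order_ideal ::
  "'a set \<Rightarrow> 'a rel \<Rightarrow> nat \<Rightarrow> ('a \<Rightarrow> nat) \<Rightarrow> ('a \<Rightarrow> nat) \<Rightarrow> ('a \<Rightarrow> int set) \<Rightarrow>
   ('a \<times> nat \<Rightarrow> int) \<Rightarrow> nat \<Rightarrow> ('a \<times> int) set" where
  "order_ideal P r l u v R f i =
     {(p, k) \<in> gamma P (R_hat P r R). k \<ge> f_hat P r l u v R f p i}"

definition Phi ::
  "'a set \<Rightarrow> 'a rel \<Rightarrow> nat \<Rightarrow> ('a \<Rightarrow> nat) \<Rightarrow> ('a \<Rightarrow> nat) \<Rightarrow> ('a \<Rightarrow> int set) \<Rightarrow>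
   ('a \<times> nat \<Rightarrow> int) \<Rightarrow> ('a \<times> int \<Rightarrow> int)" where
  "Phi P r l u v R f = (\<lambda>x\<in>gamma P (R_hat P r R).
     int (card {i \<in> {1..l}. x \<notin> order_ideal P r l u v R f i}))"

end

theory Submission
  imports Defs
begin

text \<open>
  Extend a labeling \<open>f\<close> to the map \<open>f'\<close> (\<^const>\<open>f_hat\<close>) on all of \<open>P \<times> [\<ell>]\<close>. Since \<open>f'\<close> increases weakly along fibers, the
  number \<open>\<sigma>(p, k) = \<Phi>(f)(p, k)\<close> encodes the threshold \<open>f'(p, i) > k \<longleftrightarrow> i > \<ell> - \<sigma>(p, k)\<close>; strictness
  of \<open>f'\<close> along covers of \<open>P\<close> becomes monotonicity of \<open>\<sigma>\<close> along the covers of \<open>\<Gamma>\<close> between different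
  fibers, and \<open>f\<close> can be read off from the thresholds.

  Let \<open>U\<close> and \<open>D\<close> be the minimum of \<open>\<sigma>\<close> over the upper covers and the maximum over the lower covers of
  \<open>(p, k)\<close>. Changing labels only within the fiber of \<open>p\<close> is the same as changing \<open>\<sigma>\<close> only there, so the
  raisable \<open>k\<close> are those at positions in \<open>(\<ell> - U, \<ell> - \<sigma>(p, k)]\<close> and the lowerable next labels
  those in \<open>(\<ell> - \<sigma>(p, k), \<ell> - D]\<close>. Swapping the two multiplicities moves the
  threshold from \<open>\<sigma>(p, k)\<close> to \<open>U + D - \<sigma>(p, k)\<close>, which is the toggle. Hence \<open>\<Phi>\<close> intertwines the
  \<open>k\<close>-th Bender--Knuth involution with the toggles at level \<open>k\<close>.
\<close>

section \<open>Preliminaries on finite integer sets, finite posets and final segments of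
  positions\<close>

lemma next_above_props:
  assumes "finite A" "x \<in> A" "k < x"
  shows "next_above A k \<in> A" "k < next_above A k" "\<And>y. y \<in> A \<Longrightarrow> k < y \<Longrightarrow> next_above A k \<le> y"
proof -
  have "next_above A k \<in> {x \<in> A. x > k}"
    unfolding next_above_def by (rule Min_in) (use assms in auto)
  then show "next_above A k \<in> A" "k < next_above A k" by auto
  show "\<And>y. y \<in> A \<Longrightarrow> k < y \<Longrightarrow> next_above A k \<le> y"
    unfolding next_above_def using assms by auto
qed

lemma next_below_props:
  assumes "finite A" "x \<in> A" "x < k"
  shows "next_below A k \<in> A" "next_below A k < k" "\<And>y. y \<in> A \<Longrightarrow> y < k \<Longrightarrow> y \<le> next_below A k"
proof -
  have "next_below A k \<in> {x \<in> A. x < k}"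
    unfolding next_below_def by (rule Max_in) (use assms in auto)
  then show "next_below A k \<in> A" "next_below A k < k" by auto
  show "\<And>y. y \<in> A \<Longrightarrow> y < k \<Longrightarrow> y \<le> next_below A k"
    unfolding next_below_def using assms by auto
qed

text \<open>A longest chain with least element \<open>q\<close> becomes, after \<open>p\<close> is
  added, a longer chain with least element \<open>p\<close>.\<close>

lemma height_above_less:
  assumes fin: "finite P" and po: "partial_order_on P r" and pq: "(p, q) \<in> r" "p \<noteq> q"
  shows "height_above P r q < height_above P r p"
proof -
  define S where "S x = {C. C \<subseteq> P \<and> C \<in> Chains r \<and> x \<in> C \<and> (\<forall>y\<in>C. (x, y) \<in> r)}" for x
  have rP: "r \<subseteq> P \<times> P" and rf: "refl_on P r" and tr: "trans r" and an: "antisym r"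
    using po by (auto simp: partial_order_on_def preorder_on_def)
  have finS: "finite (S x)" for x
    by (rule finite_subset[of _ "Pow P"]) (use fin in \<open>auto simp: S_def\<close>)
  have "{q} \<in> S q" using pq rP rf by (auto simp: S_def Chains_def refl_on_def)
  then have "Max (card ` S q) \<in> card ` S q" using finS[of q] by (intro Max_in) auto
  then obtain C where C: "C \<in> S q" "card C = Max (card ` S q)" by auto
  have pC: "(p, y) \<in> r" if "y \<in> C" for y
    using C(1) that pq tr by (auto simp: S_def dest: transD)
  have "p \<notin> C" using C(1) pq an by (auto simp: S_def dest: antisymD)
  have "insert p C \<in> S p"
    using C(1) pC pq rP rf by (auto simp: S_def Chains_def refl_on_def)
  then have "card (insert p C) \<le> Max (card ` S p)" using finS[of p] by (intro Max_ge) auto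
  moreover have "finite C" using C(1) fin by (auto simp: S_def intro: finite_subset)
  ultimately have "Max (card ` S q) < Max (card ` S p)"
    using C(2) \<open>p \<notin> C\<close> by simp
  then show ?thesis by (simp add: S_def height_above_def)
qed

lemma height_below_less:
  assumes "finite P" and "partial_order_on P r" and "(p, q) \<in> r" "p \<noteq> q"
  shows "height_below P r p < height_below P r q"
proof -
  have "Chains (r\<inverse>) = Chains r" by (auto simp: Chains_def)
  then have "height_below P r x = height_above P (r\<inverse>) x" for x
    by (simp add: height_below_def height_above_def)
  moreover have "partial_order_on P (r\<inverse>)" using assms(2) by simp
  ultimately show ?thesis using height_above_less[of P "r\<inverse>" q p] assms by auto
qed

lemma height_above_pos:
  assumes fin: "finite P" and po: "partial_order_on P r" and p: "p \<in> P"
  shows "height_above P r p > 0"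
proof -
  define S where "S = {C. C \<subseteq> P \<and> C \<in> Chains r \<and> p \<in> C \<and> (\<forall>y\<in>C. (p, y) \<in> r)}"
  have rf: "refl_on P r" using po by (auto simp: partial_order_on_def preorder_on_def)
  have "finite S" by (rule finite_subset[of _ "Pow P"]) (use fin in \<open>auto simp: S_def\<close>)
  moreover have "{p} \<in> S" using p rf by (auto simp: S_def Chains_def refl_on_def)
  ultimately have "card {p} \<le> Max (card ` S)" by (intro Max_ge imageI) auto
  then show ?thesis by (simp add: S_def height_above_def)
qed

lemma height_below_pos:
  assumes "finite P" and "partial_order_on P r" and "p \<in> P"
  shows "height_below P r p > 0"
proof -
  have "Chains (r\<inverse>) = Chains r" by (auto simp: Chains_def)
  then have "height_below P r p = height_above P (r\<inverse>) p"
    by (simp add: height_below_def height_above_def)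
  then show ?thesis using height_above_pos[of P "r\<inverse>" p] assms by auto
qed

text \<open>Induction on the size of the interval: an element strictly between \<open>p\<close> and
  \<open>q\<close> splits it into two smaller intervals. This is needed because the covers of
  \<Gamma> between different fibers lie over covers of \<open>P\<close> only.\<close>

lemma less_if_less_on_covers:
  fixes h :: "'a \<Rightarrow> 'b::order"
  assumes fin: "finite P" and po: "partial_order_on P r"
    and cov: "\<And>a b. covers r a b \<Longrightarrow> h a < h b"
    and pq: "(p, q) \<in> r" "p \<noteq> q"
  shows "h p < h q"
  using pq
proof (induction "card {z. (p, z) \<in> r \<and> (z, q) \<in> r}" arbitrary: p q rule: less_induct)
  case less
  have rP: "r \<subseteq> P \<times> P" and rf: "refl_on P r" and tr: "trans r" and an: "antisym r"
    using po by (auto simp: partial_order_on_def preorder_on_def)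
  let ?I = "\<lambda>p q. {z. (p, z) \<in> r \<and> (z, q) \<in> r}"
  have fI: "finite (?I p q)"
    by (rule finite_subset[OF _ fin]) (use rP in auto)
  show ?case
  proof (cases "covers r p q")
    case True
    then show ?thesis by (rule cov)
  next
    case False
    then obtain z where z: "(p, z) \<in> r" "(z, q) \<in> r" "z \<noteq> p" "z \<noteq> q"
      using less.prems by (auto simp: covers_def)
    have pq: "(p, p) \<in> r" "(q, q) \<in> r" using less.prems rP rf by (auto simp: refl_on_def)
    have "?I p z \<subset> ?I p q"
    proof (rule psubsetI)
      show "?I p z \<subseteq> ?I p q" using z tr by (auto dest: transD)
      show "?I p z \<noteq> ?I p q" using z an less.prems pq by (auto dest: antisymD)
    qed
    moreover have "?I z q \<subset> ?I p q"
    proof (rule psubsetI)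
      show "?I z q \<subseteq> ?I p q" using z tr by (auto dest: transD)
      show "?I z q \<noteq> ?I p q" using z an less.prems pq by (auto dest: antisymD)
    qed
    ultimately have "h p < h z" "h z < h q"
      using less.hyps[of p z] less.hyps[of z q] z psubset_card_mono[OF fI] by auto
    then show ?thesis by (rule less_trans)
  qed
qed

text \<open>An upward closed subset of \<open>{1..l}\<close> is a final segment, hence determined by
  its size. This turns the counts defining \<Phi> into thresholds.\<close>

lemma upclosed_iff_card:
  fixes S :: "nat set"
  assumes S: "S \<subseteq> {1..l}" and up: "\<And>i j. i \<in> S \<Longrightarrow> i \<le> j \<Longrightarrow> j \<le> l \<Longrightarrow> j \<in> S" and i: "i \<in> {1..l}"
  shows "i \<in> S \<longleftrightarrow> l < i + card S"
proof
  have fS: "finite S" using S finite_subset by blast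
  { assume "i \<in> S"
    then have "card {i..l} \<le> card S" using up fS by (intro card_mono) auto
    then show "l < i + card S" using i by auto }
  assume "l < i + card S"
  show "i \<in> S"
  proof (rule ccontr)
    assume "i \<notin> S"
    then have "i < j \<and> j \<le> l" if "j \<in> S" for j
      using that S up[of j i] i by (auto simp: not_le[symmetric])
    then have "S \<subseteq> {i<..l}" by auto
    then have "card S \<le> card {i<..l}" by (intro card_mono) auto
    then show False using \<open>l < i + card S\<close> i by auto
  qed
qed

lemma card_final_segment:
  assumes "0 \<le> s" "s \<le> int l"
  shows "int (card {i \<in> {1..l}. int l - s < int i}) = s"
proof -
  have "{i \<in> {1..l}. int l - s < int i} = {nat (int l - s)<..l}" using assms by auto
  then show ?thesis using assms by auto
qed

lemma int_composition_eqI: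
  assumes "\<forall>\<^sub>F N in sequentially. fold F [- int N..int N] x = y"
  shows "int_composition F x = y"
  unfolding int_composition_def
proof (rule the_equality)
  fix z assume "\<forall>\<^sub>F N in sequentially. fold F [- int N..int N] x = z"
  with assms have "\<forall>\<^sub>F N in sequentially. z = y" by eventually_elim simp
  then show "z = y" by simp
qed (fact assms)

section \<open>The setting and the two sentinel labels of each fiber\<close>

locale labeling_data =
  fixes P :: "'a set" and r :: "'a rel" and l :: nat
    and u v :: "'a \<Rightarrow> nat" and R :: "'a \<Rightarrow> int set"
  assumes finP: "finite P" and po: "partial_order_on P r"
    and uv: "\<And>p. p \<in> P \<Longrightarrow> u p + v p \<le> l"
    and v_mono: "\<And>p q. (p, q) \<in> r \<Longrightarrow> v p \<le> v q"
    and u_anti: "\<And>p q. (p, q) \<in> r \<Longrightarrow> u p \<ge> u q"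
    and R: "restriction_function P R"
begin

abbreviation "cells \<equiv> skew_domain P l u v"
abbreviation "labelings \<equiv> strict_labelings P r l u v R"
abbreviation "Rh \<equiv> R_hat P r R"
abbreviation "G \<equiv> gamma P Rh"
abbreviation "cov \<equiv> gamma_covers P r Rh"
abbreviation "ord \<equiv> gamma_order P r Rh"
abbreviation "B \<equiv> B_hat P r l u v R"
abbreviation "partitions \<equiv> Q_partitions G ord l B"
abbreviation "\<Phi> \<equiv> Phi P r l u v R"
abbreviation "fh \<equiv> f_hat P r l u v R"
abbreviation "BK \<equiv> bender_knuth P r l u v R"
abbreviation "TL \<equiv> toggle_level P r l u v R"

text \<open>\<open>lo\<close> and \<open>hi\<close> name the sentinels adjoined by
  \<open>R_hat\<close>, which \<open>f_hat\<close> uses outside the skew domain. Every label lies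
  strictly between them, and the height terms make both strictly increasing along
  \<open>P\<close>.\<close>

definition lo :: "'a \<Rightarrow> int" where
  "lo p = Min (\<Union>q\<in>P. R q) - int (height_above P r p)"

definition hi :: "'a \<Rightarrow> int" where
  "hi p = Max (\<Union>q\<in>P. R q) + int (height_below P r p)"

lemma r_P: "(p, q) \<in> r \<Longrightarrow> p \<in> P \<and> q \<in> P"
  using po by (auto simp: partial_order_on_def preorder_on_def)

lemma finR: "p \<in> P \<Longrightarrow> finite (R p)" and R_ne: "p \<in> P \<Longrightarrow> R p \<noteq> {}"
  using R by (auto simp: restriction_function_def)

lemma Rh_eq: "Rh p = insert (lo p) (insert (hi p) (R p))"
  by (auto simp: R_hat_def lo_def hi_def)

lemma lo_less: "p \<in> P \<Longrightarrow> q \<in> P \<Longrightarrow> x \<in> R q \<Longrightarrow> lo p < x"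
proof -
  assume *: "p \<in> P" "q \<in> P" "x \<in> R q"
  have "Min (\<Union>q\<in>P. R q) \<le> x" using * finP finR by (intro Min_le) auto
  then show ?thesis using height_above_pos[OF finP po *(1)] by (simp add: lo_def)
qed

lemma less_hi: "p \<in> P \<Longrightarrow> q \<in> P \<Longrightarrow> x \<in> R q \<Longrightarrow> x < hi p"
proof -
  assume *: "p \<in> P" "q \<in> P" "x \<in> R q"
  have "x \<le> Max (\<Union>q\<in>P. R q)" using * finP finR by (intro Max_ge) auto
  then show ?thesis using height_below_pos[OF finP po *(1)] by (simp add: hi_def)
qed

lemma lo_less_hi: "p \<in> P \<Longrightarrow> q \<in> P \<Longrightarrow> lo p < hi q"
  using lo_less[of p p] less_hi[of q p] R_ne[of p] by (meson all_not_in_conv less_trans)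

lemma lo_strict: "(p, q) \<in> r \<Longrightarrow> p \<noteq> q \<Longrightarrow> lo p < lo q"
  using height_above_less[OF finP po] by (simp add: lo_def)

lemma hi_strict: "(p, q) \<in> r \<Longrightarrow> p \<noteq> q \<Longrightarrow> hi p < hi q"
  using height_below_less[OF finP po] by (simp add: hi_def)

lemma finRh: "p \<in> P \<Longrightarrow> finite (Rh p)"
  by (simp add: Rh_eq finR)

lemma restriction_Rh: "restriction_function P Rh"
  using finRh by (auto simp: restriction_function_def Rh_eq)

lemma Min_Rh: "p \<in> P \<Longrightarrow> Min (Rh p) = lo p"
  using finRh[of p] lo_less[of p p] lo_less_hi[of p p]
  by (intro Min_eqI) (auto simp: Rh_eq less_imp_le)

lemma Max_Rh: "p \<in> P \<Longrightarrow> Max (Rh p) = hi p"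
  using finRh[of p] less_hi[of p p] lo_less_hi[of p p]
  by (intro Max_eqI) (auto simp: Rh_eq less_imp_le)

lemma star_Rh: "p \<in> P \<Longrightarrow> star (Rh p) = insert (lo p) (R p)"
  unfolding star_def Max_Rh using less_hi[of p p] lo_less_hi[of p p] by (auto simp: Rh_eq)

lemma Min_star: "p \<in> P \<Longrightarrow> Min (star (Rh p)) = lo p"
  using finR[of p] lo_less[of p p] by (intro Min_eqI) (auto simp: star_Rh less_imp_le)

lemma Max_star: "p \<in> P \<Longrightarrow> Max (star (Rh p)) = Max (R p)"
  using finR[of p] R_ne[of p] lo_less[of p p "Max (R p)"]
  by (intro Max_eqI) (auto simp: star_Rh less_imp_le)

lemma Max_R: "p \<in> P \<Longrightarrow> Max (R p) \<in> R p" "p \<in> P \<Longrightarrow> x \<in> R p \<Longrightarrow> x \<le> Max (R p)"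
  using finR R_ne by auto

lemma mem_G: "(p, k) \<in> G \<longleftrightarrow> p \<in> P \<and> (k = lo p \<or> k \<in> R p)"
  by (auto simp: gamma_def star_Rh)

lemma finG: "finite G"
  unfolding gamma_def using finP finR by (intro finite_SigmaI) (auto simp: star_Rh)

lemma B_eq: "p \<in> P \<Longrightarrow> B (p, k) =
    (if k = lo p then Some (int l - int (u p)) else if k = Max (R p) then Some (int (v p)) else None)"
  by (simp add: B_hat_def Min_star Max_star)

lemma dom_B: "(p, k) \<in> dom B \<longleftrightarrow> p \<in> P \<and> (k = lo p \<or> k = Max (R p))"
  by (auto simp: B_hat_def Min_star Max_star dom_def)

text \<open>This matches the elements that get toggled with the condition under which
  \<open>bender_knuth\<close> may change a fiber.\<close>

lemma interior_iff: "(p, k) \<in> G - dom B \<longleftrightarrow> p \<in> P \<and> k \<in> R p \<and> k \<noteq> Max (R p)"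
  using lo_less[of p p k] by (auto simp: mem_G dom_B)

lemma covers_ord: "covers ord x y \<longleftrightarrow> (x, y) \<in> cov"
  by (rule covers_gamma_order[OF po restriction_Rh])

lemma cov_G: "(x, y) \<in> cov \<Longrightarrow> x \<in> G \<and> y \<in> G"
  by (auto simp: gamma_covers_def)

lemma mem_cells: "(p, i) \<in> cells \<longleftrightarrow> p \<in> P \<and> i \<in> {1..l} \<and> u p < i \<and> i < l + 1 - v p"
  by (auto simp: skew_domain_def)

section \<open>Cover relations of \<Gamma> within and across fibers\<close>

lemma below_in_fiber:
  assumes p: "p \<in> P" and k: "k \<in> R p"
  defines "kb \<equiv> next_below (Rh p) k"
  shows "kb < k" "kb = lo p \<or> kb \<in> R p" "\<And>y. y \<in> R p \<Longrightarrow> y > kb \<Longrightarrow> k \<le> y" "((p, k), (p, kb)) \<in> cov"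
proof -
  note nb = next_below_props[OF finRh[OF p], of "lo p" k, folded kb_def]
  have kb: "kb \<in> Rh p" "kb < k" "\<And>y. y \<in> Rh p \<Longrightarrow> y < k \<Longrightarrow> y \<le> kb"
    using nb lo_less[OF p p k] by (auto simp: Rh_eq)
  show "kb < k" by (fact kb)
  show kb': "kb = lo p \<or> kb \<in> R p" using kb less_hi[OF p p k] by (auto simp: Rh_eq)
  show "\<And>y. y \<in> R p \<Longrightarrow> y > kb \<Longrightarrow> k \<le> y" using kb(3) by (force simp: Rh_eq)
  have kRh: "k \<in> Rh p" using k by (simp add: Rh_eq)
  note na = next_above_props[OF finRh[OF p] kRh kb(2)]
  have "k = next_above (Rh p) kb" using na na(3)[OF kRh kb(2)] kb(3)[OF na(1)] by force
  then show "((p, k), (p, kb)) \<in> cov" using p k kb' by (simp add: gamma_covers_def mem_G)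
qed

text \<open>As \<open>k\<close> is not the maximum of \<open>R p\<close>, its successor in
  \<open>Rh p\<close> already lies in \<open>R p\<close>, so the label used by
  \<open>bender_knuth\<close> is also the one in the cover relation. The predecessor, in contrast,
  has to be taken in \<open>Rh p\<close>, since it may be \<open>lo p\<close>.\<close>

lemma above_in_fiber:
  assumes p: "p \<in> P" and k: "k \<in> R p" "k \<noteq> Max (R p)"
  defines "ka \<equiv> next_above (R p) k"
  shows "k < ka" "ka \<in> R p" "\<And>y. y \<in> R p \<Longrightarrow> y > k \<Longrightarrow> ka \<le> y" "((p, ka), (p, k)) \<in> cov"
proof -
  have "k < Max (R p)" using Max_R(2)[OF p k(1)] k(2) by simp
  note na = next_above_props[OF finR[OF p] Max_R(1)[OF p] this, folded ka_def]
  show "k < ka" "ka \<in> R p" "\<And>y. y \<in> R p \<Longrightarrow> y > k \<Longrightarrow> ka \<le> y" by (fact na)+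
  have kaRh: "ka \<in> Rh p" using na by (simp add: Rh_eq)
  note nh = next_above_props[OF finRh[OF p] kaRh na(2)]
  have "ka \<le> next_above (Rh p) k"
    using nh(1,2) na less_hi[OF p p na(1)] lo_less[OF p p k(1)] by (auto simp: Rh_eq)
  then have "ka = next_above (Rh p) k" using nh(3)[OF kaRh na(2)] by simp
  then show "((p, ka), (p, k)) \<in> cov" using p k na by (simp add: gamma_covers_def mem_G)
qed

text \<open>The pair \<open>(p, k)\<close>, with \<open>k\<close> the predecessor of
  \<open>m\<close> in \<open>Rh p\<close>, need not be covered by \<open>(q, m)\<close>: the second
  clause of the cover relation asks for the largest label of \<open>q\<close> with that predecessor.
  Moving from \<open>m\<close> up to this label \<open>n\<close> repairs this.\<close>

lemma cov_across:
  assumes pq: "covers r p q" and m: "(q, m) \<in> G"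
  obtains k n where "((p, k), (q, n)) \<in> cov" "m \<le> n" "k < m" "\<And>x. x \<in> Rh p \<Longrightarrow> x < m \<Longrightarrow> x \<le> k"
proof -
  have pq': "(p, q) \<in> r" "p \<noteq> q" using pq by (auto simp: covers_def)
  have P: "p \<in> P" "q \<in> P" using r_P[OF pq'(1)] by auto
  have m': "m = lo q \<or> m \<in> R q" using m by (simp add: mem_G)
  have lom: "lo p < m" using m' lo_strict[OF pq'] lo_less[OF P] by auto
  have mhi: "m < hi p" using m' lo_less_hi[OF P(2,1)] less_hi[OF P] by auto
  define k where "k = next_below (Rh p) m"
  have lo_Rh: "lo p \<in> Rh p" by (simp add: Rh_eq)
  note k = next_below_props[OF finRh[OF P(1)] lo_Rh lom, folded k_def]
  have kG: "(p, k) \<in> G" and khi: "k \<noteq> hi p" using k mhi P by (auto simp: mem_G Rh_eq)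
  define S where "S = {x \<in> Rh q. m \<le> x \<and> next_below (Rh p) x = k}"
  have mS: "m \<in> S" using m' by (auto simp: S_def Rh_eq k_def)
  have finS: "finite S" using finRh[OF P(2)] by (simp add: S_def)
  define n where "n = Max S"
  have nS: "n \<in> S" unfolding n_def using mS finS by (intro Max_in) auto
  have mx: "x \<le> n" if "x \<in> S" for x unfolding n_def using finS that by simp
  \<comment> \<open>The label \<open>hi q\<close> does not occur in \<Gamma>, so \<open>n\<close>
    must avoid it. Since \<open>hi p < hi q\<close>, the predecessor of \<open>hi q\<close> in
    \<open>Rh p\<close> is at least \<open>hi p\<close>, hence different from
    \<open>k\<close>.\<close>
  have "next_below (Rh p) (hi q) \<ge> hi p"
    using next_below_props(3)[OF finRh[OF P(1)] lo_Rh lo_less_hi[OF P], of "hi p"] hi_strict[OF pq']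
    by (simp add: Rh_eq)
  then have "n \<noteq> hi q" using nS k(2) mhi by (auto simp: S_def)
  then have nG: "(q, n) \<in> G" using nS P by (auto simp: S_def mem_G Rh_eq)
  have "((p, k), (q, n)) \<in> cov"
    unfolding gamma_covers_def
    using kG nG pq khi nS mx lo_Rh lom Max_Rh[OF P(1)]
    by (force simp: S_def)
  then show thesis using that k(2,3) nS by (auto simp: S_def)
qed

section \<open>The extended labeling on all positions\<close>

lemma f_hat_cells: "(p, i) \<in> cells \<Longrightarrow> fh f p i = f (p, i)"
  by (simp add: mem_cells f_hat_def)

lemma f_hat_lo: "p \<in> P \<Longrightarrow> i \<le> u p \<Longrightarrow> fh f p i = lo p"
  by (simp add: f_hat_def Min_Rh)

lemma f_hat_hi: "p \<in> P \<Longrightarrow> l + 1 - v p \<le> i \<Longrightarrow> fh f p i = hi p"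
  using uv[of p] by (auto simp: f_hat_def Max_Rh)

lemma position_cases:
  assumes "p \<in> P" "i \<in> {1..l}"
  obtains "i \<le> u p" | "(p, i) \<in> cells" | "l + 1 - v p \<le> i"
  using assms by (fastforce simp: mem_cells)

lemma labelings_R: "f \<in> labelings \<Longrightarrow> (p, i) \<in> cells \<Longrightarrow> f (p, i) \<in> R p"
  by (auto simp: strict_labelings_def PiE_def Pi_def)

lemma f_hat_Rh: "f \<in> labelings \<Longrightarrow> p \<in> P \<Longrightarrow> i \<in> {1..l} \<Longrightarrow> fh f p i \<in> Rh p"
  by (cases rule: position_cases[of p i])
    (auto simp: f_hat_lo f_hat_hi f_hat_cells labelings_R Rh_eq)

text \<open>The sentinels are not in \<open>R p\<close>, so the skew domain can be recognised from
  the values of the extended labeling.\<close>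

lemma f_hat_R_iff:
  "f \<in> labelings \<Longrightarrow> p \<in> P \<Longrightarrow> i \<in> {1..l} \<Longrightarrow> fh f p i \<in> R p \<longleftrightarrow> (p, i) \<in> cells"
  using lo_less[of p p "lo p"] less_hi[of p p "hi p"]
  by - (cases rule: position_cases[of p i],
    auto simp: f_hat_lo f_hat_hi f_hat_cells labelings_R mem_cells)

text \<open>Monotonicity of \<open>u\<close> and \<open>v\<close> rules out that \<open>q\<close> is
  still at its lower sentinel while \<open>p\<close> is past its own, or that \<open>p\<close> has
  reached its upper sentinel before \<open>q\<close>. Two equal kinds of sentinel compare strictly
  by the height terms.\<close>

lemma f_hat_strict:
  assumes f: "f \<in> labelings" and pq: "(p, q) \<in> r" "p \<noteq> q" and i: "i \<in> {1..l}"
  shows "fh f p i < fh f q i"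
proof -
  have P: "p \<in> P" "q \<in> P" using r_P[OF pq(1)] by auto
  have uvm: "v p \<le> v q" "u q \<le> u p" using v_mono u_anti pq by auto
  show ?thesis
  proof (cases rule: position_cases[OF P(1) i])
    case 1
    then have p: "fh f p i = lo p" using P by (simp add: f_hat_lo)
    show ?thesis using f_hat_Rh[OF f P(2) i] lo_strict[OF pq] lo_less[OF P] lo_less_hi[OF P]
      by (auto simp: p Rh_eq)
  next
    case p: 2
    show ?thesis
    proof (cases rule: position_cases[OF P(2) i])
      case 1
      then show ?thesis using p uvm by (simp add: mem_cells)
    next
      case 2
      then have "f (p, i) < f (q, i)" using p f pq by (auto simp: strict_labelings_def)
      then show ?thesis using p 2 by (simp add: f_hat_cells)
    next
      case 3
      then show ?thesis using p P labelings_R[OF f p] less_hi[OF P(2,1)]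
        by (simp add: f_hat_cells f_hat_hi)
    qed
  next
    case 3
    then show ?thesis using P uvm hi_strict[OF pq] by (simp add: f_hat_hi)
  qed
qed

lemma f_hat_mono:
  assumes f: "f \<in> labelings" and p: "p \<in> P" and ij: "1 \<le> i" "i \<le> j" "j \<le> l"
  shows "fh f p i \<le> fh f p j"
proof -
  have i: "i \<in> {1..l}" and j: "j \<in> {1..l}" using ij by auto
  show ?thesis
  proof (cases rule: position_cases[OF p i])
    case 1
    then show ?thesis using f_hat_Rh[OF f p j] p lo_less[OF p p] lo_less_hi[OF p p]
      by (force simp: f_hat_lo Rh_eq)
  next
    case i2: 2
    show ?thesis
    proof (cases rule: position_cases[OF p j])
      case 1
      then show ?thesis using i2 ij by (simp add: mem_cells)
    next
      case 2
      then have "f (p, i) \<le> f (p, j)" using i2 f ij by (auto simp: strict_labelings_def)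
      then show ?thesis using i2 2 by (simp add: f_hat_cells)
    next
      case 3
      then show ?thesis using p i2 labelings_R[OF f i2] less_hi[OF p p]
        by (force simp: f_hat_cells f_hat_hi)
    qed
  next
    case 3
    then show ?thesis using p ij by (simp add: f_hat_hi)
  qed
qed

section \<open>From labelings to \<open>Q\<close>-partitions\<close>

lemma Phi_eq: "(p, k) \<in> G \<Longrightarrow> \<Phi> f (p, k) = int (card {i \<in> {1..l}. k < fh f p i})"
  by (simp add: Phi_def order_ideal_def not_le)

lemma Phi_range:
  assumes "(p, k) \<in> G" shows "0 \<le> \<Phi> f (p, k) \<and> \<Phi> f (p, k) \<le> int l"
proof -
  have "card {i \<in> {1..l}. k < fh f p i} \<le> card {1..l}" by (intro card_mono) auto
  then show ?thesis by (simp add: Phi_eq[OF assms])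
qed

text \<open>Labels increase weakly along the fiber, so the positions with label above
  \<open>k\<close> are upward closed and their number determines them. Later arguments about labels
  pass through this threshold.\<close>

lemma f_hat_gt_iff:
  assumes f: "f \<in> labelings" and pk: "(p, k) \<in> G" and i: "i \<in> {1..l}"
  shows "k < fh f p i \<longleftrightarrow> int l - \<Phi> f (p, k) < int i"
proof -
  have p: "p \<in> P" using pk by (simp add: mem_G)
  let ?S = "{i \<in> {1..l}. k < fh f p i}"
  have "i \<in> ?S \<longleftrightarrow> l < i + card ?S"
  proof (rule upclosed_iff_card[OF _ _ i])
    show "j \<in> ?S" if "i \<in> ?S" "i \<le> j" "j \<le> l" for i j
      using that f_hat_mono[OF f p, of i j] by auto
  qed auto
  then show ?thesis using i by (auto simp: Phi_eq[OF pk])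
qed

text \<open>The first \<open>u p\<close> positions are those whose label fails to exceed
  \<open>lo p\<close>, and the last \<open>v p\<close> positions are those whose label exceeds
  \<open>Max (R p)\<close>. Counting gives the two boundary values.\<close>

lemma Phi_B:
  assumes f: "f \<in> labelings" and x: "x \<in> dom B"
  shows "B x = Some (\<Phi> f x)"
proof -
  obtain p k where [simp]: "x = (p, k)" by fastforce
  have p: "p \<in> P" and k: "k = lo p \<or> k = Max (R p)" using x by (auto simp: dom_B)
  have G: "(p, k) \<in> G" using p k Max_R(1) by (auto simp: mem_G)
  show ?thesis
  proof (cases "k = lo p")
    case True
    have "lo p < fh f p i \<longleftrightarrow> u p < i" if "i \<in> {1..l}" for i
      using that p lo_less[OF p p] lo_less_hi[OF p p] uv[OF p] labelings_R[OF f]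
      by - (cases rule: position_cases[OF p that],
        auto simp: f_hat_lo f_hat_hi f_hat_cells mem_cells)
    then have "{i \<in> {1..l}. lo p < fh f p i} = {u p<..l}" by auto
    then show ?thesis using True p uv[OF p] G by (auto simp: B_eq Phi_eq)
  next
    case False
    then have kM: "k = Max (R p)" using k by simp
    have "k < fh f p i \<longleftrightarrow> l - v p < i" if "i \<in> {1..l}" for i
      using that p lo_less[OF p p Max_R(1)[OF p]] less_hi[OF p p Max_R(1)[OF p]] uv[OF p]
        Max_R(2)[OF p labelings_R[OF f], of i]
      by - (cases rule: position_cases[OF p that],
        auto simp: f_hat_lo f_hat_hi f_hat_cells mem_cells kM not_less)
    then have "{i \<in> {1..l}. k < fh f p i} = {l - v p<..l}" by auto
    then show ?thesis using False kM p uv[OF p] G by (auto simp: B_eq Phi_eq)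
  qed
qed

text \<open>Inside a fiber fewer labels exceed the larger bound. Across a cover of \<open>P\<close>,
  \<open>k\<close> is the largest label of \<open>Rh p\<close> below \<open>m\<close>, so a label of
  \<open>p\<close> above \<open>k\<close> is at least \<open>m\<close>, and strictness pushes the
  label of \<open>q\<close> above \<open>m\<close>.\<close>

lemma Phi_cov:
  assumes f: "f \<in> labelings" and c: "(x, y) \<in> cov"
  shows "\<Phi> f x \<le> \<Phi> f y"
proof -
  obtain p k q m where [simp]: "x = (p, k)" "y = (q, m)" by fastforce
  have G: "(p, k) \<in> G" "(q, m) \<in> G" using cov_G[OF c] by auto
  have P: "p \<in> P" using G by (simp add: mem_G)
  have "m < fh f q i" if i: "i \<in> {1..l}" and k: "k < fh f p i" for i
  proof (cases "p = q")
    case True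
    then show ?thesis using gamma_covers_same(1)[OF restriction_Rh, of p k m r] c k by simp
  next
    case False
    note d = gamma_covers_diff[OF restriction_Rh c[simplified] False]
    have "m \<le> fh f p i" using d(3)[OF f_hat_Rh[OF f P i]] k by linarith
    also have "\<dots> < fh f q i"
      using f_hat_strict[OF f _ _ i] d(1) by (auto simp: covers_def)
    finally show ?thesis .
  qed
  then have "{i \<in> {1..l}. k < fh f p i} \<subseteq> {i \<in> {1..l}. m < fh f q i}" by auto
  then show ?thesis using G by (simp add: Phi_eq card_mono)
qed

lemma ord_mono:
  fixes h :: "'a \<times> int \<Rightarrow> int"
  assumes "\<And>x y. (x, y) \<in> cov \<Longrightarrow> h x \<le> h y" and "(x, y) \<in> ord"
  shows "h x \<le> h y"
proof -
  have "h x \<le> h y" if "(x, y) \<in> cov\<^sup>+"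
    using that by (induction rule: trancl_induct) (use assms(1) order_trans in blast)+
  then show ?thesis using assms(2) by (auto simp: gamma_order_def)
qed

text \<open>Elements outside \<open>dom B\<close> have neighbours above and below in their own
  fiber, so they are neither minimal nor maximal. The range and monotonicity of \<open>B\<close> are
  inherited from \<open>\<Phi> f\<close>, of which \<open>B\<close> is a restriction.\<close>

lemma boundary_map_B:
  assumes f: "f \<in> labelings"
  shows "boundary_map G ord l B"
  unfolding boundary_map_def
proof (intro conjI)
  show domG: "dom B \<subseteq> G"
  proof
    fix x assume "x \<in> dom B"
    moreover obtain p k where "x = (p, k)" by fastforce
    ultimately show "x \<in> G" using Max_R(1)[of p] dom_B[of p k] by (auto simp only: mem_G)
  qed
  have cov_ord: "(x, y) \<in> ord" if "(x, y) \<in> cov" for x y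
    using that by (auto simp: gamma_order_def)
  show "{x \<in> G. \<forall>y. (y, x) \<in> ord \<longrightarrow> y = x} \<subseteq> dom B"
  proof (rule subsetI, rule ccontr)
    fix x assume *: "x \<in> {x \<in> G. \<forall>y. (y, x) \<in> ord \<longrightarrow> y = x}" "x \<notin> dom B"
    obtain p k where x: "x = (p, k)" by fastforce
    then have "p \<in> P" "k \<in> R p" "k \<noteq> Max (R p)" using * interior_iff by blast+
    note a = above_in_fiber(1,4)[OF this]
    then have "(p, next_above (R p) k) = x" using * cov_ord x by blast
    then show False using a(1) x by simp
  qed
  show "{x \<in> G. \<forall>y. (x, y) \<in> ord \<longrightarrow> y = x} \<subseteq> dom B"
  proof (rule subsetI, rule ccontr)
    fix x assume *: "x \<in> {x \<in> G. \<forall>y. (x, y) \<in> ord \<longrightarrow> y = x}" "x \<notin> dom B"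
    obtain p k where x: "x = (p, k)" by fastforce
    then have "p \<in> P" "k \<in> R p" using * interior_iff by blast+
    note b = below_in_fiber(1,4)[OF this]
    then have "(p, next_below (Rh p) k) = x" using * cov_ord x by blast
    then show False using b(1) x by simp
  qed
  show "ran B \<subseteq> {0..int l}"
  proof
    fix b assume "b \<in> ran B"
    then obtain x where x: "B x = Some b" by (auto simp: ran_def)
    then have d: "x \<in> dom B" by auto
    then have "b = \<Phi> f x" using Phi_B[OF f d] x by simp
    then show "b \<in> {0..int l}" using Phi_range domG d by (cases x) auto
  qed
  show "monotone_on (dom B) (\<lambda>x y. (x, y) \<in> ord) (\<le>) (\<lambda>x. the (B x))"
    unfolding monotone_on_def using ord_mono[of "\<Phi> f", OF Phi_cov[OF f]] Phi_B[OF f]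
    by (metis option.sel)
qed

lemma Phi_partition:
  assumes f: "f \<in> labelings" shows "\<Phi> f \<in> partitions"
  unfolding Q_partitions_def
proof (intro CollectI conjI ballI)
  show "\<Phi> f \<in> G \<rightarrow>\<^sub>E {0..int l}"
  proof (rule PiE_I)
    show "\<Phi> f x \<in> {0..int l}" if "x \<in> G" for x using Phi_range that by (cases x) auto
  qed (simp add: Phi_def)
  show "boundary_map G ord l B" by (rule boundary_map_B[OF f])
  show "monotone_on G (\<lambda>x y. (x, y) \<in> ord) (\<le>) (\<Phi> f)"
    by (intro monotone_onI) (rule ord_mono[of "\<Phi> f", OF Phi_cov[OF f]])
  show "B x = Some (\<Phi> f x)" if "x \<in> dom B" for x by (rule Phi_B[OF f that])
qed

section \<open>The inverse of \<Phi>\<close>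

lemma partitions_cov: "\<sigma> \<in> partitions \<Longrightarrow> (x, y) \<in> cov \<Longrightarrow> \<sigma> x \<le> \<sigma> y"
  using cov_G[of x y] by (auto simp: Q_partitions_def monotone_on_def gamma_order_def)

lemma partitions_range: "\<sigma> \<in> partitions \<Longrightarrow> x \<in> G \<Longrightarrow> 0 \<le> \<sigma> x \<and> \<sigma> x \<le> int l"
  by (cases x) (auto simp: Q_partitions_def PiE_def Pi_def)

text \<open>Descend from \<open>m\<close> to \<open>k\<close> through consecutive labels of the
  fiber; each step is a cover of \<Gamma>.\<close>

lemma partitions_fiber:
  assumes \<sigma>: "\<sigma> \<in> partitions" and p: "(p, k) \<in> G" "(p, m) \<in> G" and "k \<le> m"
  shows "\<sigma> (p, m) \<le> \<sigma> (p, k)"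
  using p \<open>k \<le> m\<close>
proof (induction "nat (m - k)" arbitrary: m rule: less_induct)
  case less
  show ?case
  proof (cases "k = m")
    case False
    then have km: "k < m" using less.prems by simp
    have P: "p \<in> P" using less.prems by (simp add: mem_G)
    have m: "m \<in> R p" using less.prems km lo_less[OF P P, of k] by (auto simp: mem_G)
    note b = below_in_fiber[OF P m]
    have "k \<in> Rh p" "lo p \<in> Rh p" using less.prems by (auto simp: mem_G Rh_eq)
    then have "k \<le> next_below (Rh p) m"
      using next_below_props(3)[OF finRh[OF P]] km by blast
    then have "\<sigma> (p, next_below (Rh p) m) \<le> \<sigma> (p, k)"
      using less.hyps[of "next_below (Rh p) m"] b P less.prems km by (auto simp: mem_G)
    then show ?thesis using partitions_cov[OF \<sigma> b(4)] by simp
  qed simp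
qed

text \<open>The label at position \<open>i\<close> is the smallest one whose threshold has not been
  passed at \<open>i\<close>. The disjunct for \<open>hi p\<close> supplies a default, as
  \<open>(p, hi p)\<close> lies outside \<Gamma>.\<close>

definition unPhi :: "('a \<times> int \<Rightarrow> int) \<Rightarrow> 'a \<Rightarrow> nat \<Rightarrow> int" where
  "unPhi \<sigma> p i = Min {x \<in> Rh p. x = hi p \<or> int i \<le> int l - \<sigma> (p, x)}"

lemma unPhi_Rh: "p \<in> P \<Longrightarrow> unPhi \<sigma> p i \<in> Rh p"
proof -
  assume p: "p \<in> P"
  have "unPhi \<sigma> p i \<in> {x \<in> Rh p. x = hi p \<or> int i \<le> int l - \<sigma> (p, x)}"
    unfolding unPhi_def by (intro Min_in) (use finRh[OF p] in \<open>auto simp: Rh_eq\<close>)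
  then show ?thesis by simp
qed

text \<open>The counterpart of \<open>f_hat_gt_iff\<close>. As \<sigma> decreases weakly in the
  label, the set minimised in \<open>unPhi\<close> is upward closed in \<open>Rh p\<close>, so its
  minimum exceeds \<open>k\<close> exactly when \<open>k\<close> is not a member.\<close>

lemma unPhi_gt_iff:
  assumes \<sigma>: "\<sigma> \<in> partitions" and pk: "(p, k) \<in> G"
  shows "k < unPhi \<sigma> p i \<longleftrightarrow> int l - \<sigma> (p, k) < int i"
proof -
  have p: "p \<in> P" using pk by (simp add: mem_G)
  let ?S = "{x \<in> Rh p. x = hi p \<or> int i \<le> int l - \<sigma> (p, x)}"
  have fin: "finite ?S" and ne: "?S \<noteq> {}" using finRh[OF p] by (auto simp: Rh_eq)
  have k: "k \<in> Rh p" "k < hi p" using pk less_hi[OF p p] lo_less_hi[OF p p] by (auto simp: mem_G Rh_eq)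
  have "k < Min ?S \<longleftrightarrow> (\<forall>x\<in>?S. k < x)" using fin ne by simp
  also have "\<dots> \<longleftrightarrow> int l - \<sigma> (p, k) < int i"
  proof
    assume "\<forall>x\<in>?S. k < x"
    then have "k \<notin> ?S" by blast
    then show "int l - \<sigma> (p, k) < int i" using k by auto
  next
    assume i: "int l - \<sigma> (p, k) < int i"
    show "\<forall>x\<in>?S. k < x"
    proof (rule ballI, rule ccontr)
      fix x assume x: "x \<in> ?S" "\<not> k < x"
      then have "x \<noteq> hi p" using k by auto
      moreover from this have "(p, x) \<in> G" using x p by (auto simp: mem_G Rh_eq)
      then have "\<sigma> (p, k) \<le> \<sigma> (p, x)" using partitions_fiber[OF \<sigma> _ pk] x by simp
      ultimately show False using x i by auto
    qed
  qed
  finally show ?thesis unfolding unPhi_def .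
qed

text \<open>It suffices to treat covers of \<open>P\<close>. If the label \<open>m\<close> at
  \<open>q\<close> is not \<open>hi q\<close>, \<open>cov_across\<close> gives a cover of
  \<open>(p, k)\<close> by \<open>(q, n)\<close> with \<open>k < m\<close> and
  \<open>m \<le> n\<close>. The label at \<open>q\<close> does not exceed \<open>n\<close>, so by
  monotonicity of \<sigma> the label at \<open>p\<close> does not exceed \<open>k\<close>.\<close>

lemma unPhi_strict:
  assumes \<sigma>: "\<sigma> \<in> partitions" and pq: "(p, q) \<in> r" "p \<noteq> q"
  shows "unPhi \<sigma> p i < unPhi \<sigma> q i"
proof (rule less_if_less_on_covers[OF finP po _ pq, where h = "\<lambda>p. unPhi \<sigma> p i"])
  fix p q assume c: "covers r p q"
  have pq': "(p, q) \<in> r" "p \<noteq> q" using c by (auto simp: covers_def)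
  have P: "p \<in> P" "q \<in> P" using r_P[OF pq'(1)] by auto
  define m where "m = unPhi \<sigma> q i"
  show "unPhi \<sigma> p i < unPhi \<sigma> q i"
  proof (cases "m = hi q")
    case True
    then show ?thesis
      using unPhi_Rh[OF P(1), of \<sigma> i] hi_strict[OF pq'] lo_less_hi[OF P] less_hi[OF P(2,1)]
      by (auto simp: m_def Rh_eq)
  next
    case False
    then have mG: "(q, m) \<in> G"
      using unPhi_Rh[OF P(2), of \<sigma> i] P by (auto simp: mem_G Rh_eq m_def)
    obtain k n where kn: "((p, k), (q, n)) \<in> cov" "m \<le> n" "k < m"
      "\<And>x. x \<in> Rh p \<Longrightarrow> x < m \<Longrightarrow> x \<le> k" using cov_across[OF c mG] by blast
    have G: "(p, k) \<in> G" "(q, n) \<in> G" using cov_G[OF kn(1)] by auto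
    have "\<not> n < unPhi \<sigma> q i" using kn(2) by (simp add: m_def)
    then have "\<not> k < unPhi \<sigma> p i"
      using unPhi_gt_iff[OF \<sigma>] G partitions_cov[OF \<sigma> kn(1)] by simp
    then show ?thesis using kn(3) by (simp add: m_def)
  qed
qed

lemma partitions_B:
  assumes \<sigma>: "\<sigma> \<in> partitions" and p: "p \<in> P"
  shows "\<sigma> (p, lo p) = int l - int (u p)" "\<sigma> (p, Max (R p)) = int (v p)"
proof -
  have b: "B x = Some (\<sigma> x)" if "x \<in> dom B" for x using \<sigma> that by (auto simp: Q_partitions_def)
  have "lo p \<noteq> Max (R p)" using lo_less[OF p p Max_R(1)[OF p]] by simp
  then show "\<sigma> (p, lo p) = int l - int (u p)" "\<sigma> (p, Max (R p)) = int (v p)"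
    using b[of "(p, lo p)"] b[of "(p, Max (R p))"] p by (auto simp: dom_B B_eq)
qed

lemma Phi_surj:
  assumes \<sigma>: "\<sigma> \<in> partitions"
  shows "\<exists>f\<in>labelings. \<Phi> f = \<sigma>"
proof -
  define f where "f = (\<lambda>(p, i)\<in>cells. unPhi \<sigma> p i)"
  \<comment> \<open>The prescribed boundary values are the thresholds of \<open>lo p\<close> and
    \<open>Max (R p)\<close>. They place the sentinels exactly outside the skew domain, so that
    \<open>unPhi\<close> is the extended labeling of its restriction \<open>f\<close>.\<close>
  have pos: "(i \<le> u p \<longrightarrow> unPhi \<sigma> p i = lo p) \<and> ((p, i) \<in> cells \<longrightarrow> unPhi \<sigma> p i \<in> R p) \<and>
      (l + 1 - v p \<le> i \<longrightarrow> unPhi \<sigma> p i = hi p)" if p: "p \<in> P" for p i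
  proof -
    have G: "(p, lo p) \<in> G" "(p, Max (R p)) \<in> G" using p Max_R(1) by (auto simp: mem_G)
    have "lo p < unPhi \<sigma> p i \<longleftrightarrow> u p < i" "Max (R p) < unPhi \<sigma> p i \<longleftrightarrow> l - v p < i"
      using unPhi_gt_iff[OF \<sigma> G(1), of i] unPhi_gt_iff[OF \<sigma> G(2), of i] partitions_B[OF \<sigma> p] uv[OF p]
      by auto
    then show ?thesis
      using unPhi_Rh[OF p, of \<sigma> i] lo_less[OF p p] lo_less_hi[OF p p] Max_R[OF p]
        less_hi[OF p p Max_R(1)[OF p]] lo_less[OF p p Max_R(1)[OF p]] uv[OF p]
      by (fastforce simp: Rh_eq mem_cells)
  qed
  have fc: "f (p, i) = unPhi \<sigma> p i" if "(p, i) \<in> cells" for p i using that by (simp add: f_def)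
  have "f \<in> labelings"
    unfolding strict_labelings_def
  proof (intro CollectI conjI allI impI)
    show "f \<in> (\<Pi>\<^sub>E (p, i)\<in>cells. R p)"
    proof (rule PiE_I)
      fix x assume "x \<in> cells"
      then show "f x \<in> (case x of (p, i) \<Rightarrow> R p)"
        using pos fc by (cases x) (auto simp: mem_cells)
    next
      fix x assume "x \<notin> cells"
      then show "f x = undefined" by (simp add: f_def)
    qed
    show "f (p, i) < f (q, i)" if "(p, i) \<in> cells" "(q, i) \<in> cells" "(p, q) \<in> r" "p \<noteq> q" for p q i
      using that unPhi_strict[OF \<sigma>] fc by simp
    show "f (p, i) \<le> f (p, j)" if *: "(p, i) \<in> cells" "(p, j) \<in> cells" "i \<le> j" for p i j
    proof (rule ccontr)
      \<comment> \<open>Test both positions against the label at \<open>j\<close>: once its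
        threshold is passed at \<open>i\<close>, it is passed at the later \<open>j\<close> as
        well.\<close>
      assume "\<not> f (p, i) \<le> f (p, j)"
      then have lt: "unPhi \<sigma> p j < unPhi \<sigma> p i" using fc * by simp
      have p: "p \<in> P" using * by (simp add: mem_cells)
      then have G: "(p, unPhi \<sigma> p j) \<in> G" using pos[of p j] * by (simp add: mem_G)
      show False using unPhi_gt_iff[OF \<sigma> G, of i] unPhi_gt_iff[OF \<sigma> G, of j] lt * by simp
    qed
  qed
  moreover have "\<Phi> f = \<sigma>"
  proof
    fix x
    show "\<Phi> f x = \<sigma> x"
    proof (cases "x \<in> G")
      case True
      obtain p k where [simp]: "x = (p, k)" by fastforce
      have p: "p \<in> P" using True by (simp add: mem_G)
      have "fh f p i = unPhi \<sigma> p i" if i: "i \<in> {1..l}" for i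
        using pos[OF p, of i] p
        by - (cases rule: position_cases[OF p i], auto simp: f_hat_lo f_hat_hi f_hat_cells fc)
      then have "{i \<in> {1..l}. k < fh f p i} = {i \<in> {1..l}. int l - \<sigma> (p, k) < int i}"
        using unPhi_gt_iff[OF \<sigma>] True by auto
      then show ?thesis
        using Phi_eq[of p k f] card_final_segment[of "\<sigma> (p, k)" l] True partitions_range[OF \<sigma> True] by simp
    next
      case False
      then show ?thesis using \<sigma> by (cases x) (auto simp: Phi_def Q_partitions_def PiE_def extensional_def)
    qed
  qed
  ultimately show ?thesis by blast
qed

text \<open>Two elements of \<open>R p\<close> that compare alike with every element of
  \<open>R p\<close> coincide. The form for a single fiber also shows that changing \<sigma> over
  \<open>p\<close> leaves the labels of other fibers alone.\<close>

lemma Phi_fiber_inj: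
  assumes f: "f \<in> labelings" and g: "g \<in> labelings"
    and eq: "\<And>k. (p, k) \<in> G \<Longrightarrow> \<Phi> f (p, k) = \<Phi> g (p, k)" and c: "(p, i) \<in> cells"
  shows "f (p, i) = g (p, i)"
proof -
  have p: "p \<in> P" and i: "i \<in> {1..l}" using c by (auto simp: mem_cells)
  have iff: "k < f (p, i) \<longleftrightarrow> k < g (p, i)" if "k \<in> R p" for k
    using f_hat_gt_iff[OF f _ i, of p k] f_hat_gt_iff[OF g _ i, of p k] eq[of k] that p c
    by (simp add: mem_G f_hat_cells)
  show ?thesis
    using iff[OF labelings_R[OF f c]] iff[OF labelings_R[OF g c]] by auto
qed

lemma Phi_bij: "bij_betw \<Phi> labelings partitions"
proof (rule bij_betw_imageI)
  show "inj_on \<Phi> labelings"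
  proof (rule inj_onI)
    fix f g assume *: "f \<in> labelings" "g \<in> labelings" "\<Phi> f = \<Phi> g"
    show "f = g"
    proof
      fix x
      show "f x = g x"
      proof (cases "x \<in> cells")
        case True
        then show ?thesis using Phi_fiber_inj[OF *(1,2)] *(3) by (cases x) auto
      next
        case False
        then show ?thesis using * by (cases x) (auto simp: strict_labelings_def PiE_def extensional_def)
      qed
    qed
  qed
  show "\<Phi> ` labelings = partitions" using Phi_partition Phi_surj by blast
qed

section \<open>Toggles and their composition on one level\<close>

lemma finite_cov: "finite {y. (x, y) \<in> cov}" "finite {z. (z, x) \<in> cov}"
  by (rule finite_subset[OF _ finG]; use cov_G in blast)+

text \<open>Elements on the same level are never in a cover relation, so toggles on one level do not
  read each other's values.\<close>

lemma cov_snd: "(x, y) \<in> cov \<Longrightarrow> snd x \<noteq> snd y"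
  using gamma_covers_same(1)[OF restriction_Rh, of "fst x" "snd x" "snd y" r]
    gamma_covers_diff(2)[OF restriction_Rh, of "fst x" "snd x" "fst y" "snd y" r]
  by (cases x, cases y) fastforce

definition up :: "('a \<times> int \<Rightarrow> int) \<Rightarrow> 'a \<times> int \<Rightarrow> int" where
  "up \<sigma> x = Min (\<sigma> ` {y. (x, y) \<in> cov})"

definition dn :: "('a \<times> int \<Rightarrow> int) \<Rightarrow> 'a \<times> int \<Rightarrow> int" where
  "dn \<sigma> x = Max (\<sigma> ` {z. (z, x) \<in> cov})"

lemma toggle_eq: "toggle ord x \<sigma> = \<sigma>(x := up \<sigma> x + dn \<sigma> x - \<sigma> x)"
  by (simp add: toggle_def covers_ord up_def dn_def)

text \<open>An interior element is covered by its predecessor in the same fiber, so the minimum is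
  taken over a nonempty finite set.\<close>

lemma le_up_iff:
  assumes "x \<in> G - dom B" shows "c \<le> up \<sigma> x \<longleftrightarrow> (\<forall>y. (x, y) \<in> cov \<longrightarrow> c \<le> \<sigma> y)"
proof -
  obtain p k where x: "x = (p, k)" by fastforce
  then have "p \<in> P" "k \<in> R p" using assms interior_iff by blast+
  then have "{y. (x, y) \<in> cov} \<noteq> {}" using below_in_fiber(4) x by blast
  then show ?thesis using finite_cov by (auto simp: up_def)
qed

lemma dn_le_iff:
  assumes "x \<in> G - dom B" shows "dn \<sigma> x \<le> c \<longleftrightarrow> (\<forall>z. (z, x) \<in> cov \<longrightarrow> \<sigma> z \<le> c)"
proof -
  obtain p k where x: "x = (p, k)" by fastforce
  then have "p \<in> P" "k \<in> R p" "k \<noteq> Max (R p)" using assms interior_iff by blast+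
  then have "{z. (z, x) \<in> cov} \<noteq> {}" using above_in_fiber(4) x by blast
  then show ?thesis using finite_cov by (auto simp: dn_def)
qed

lemma up_bounds:
  assumes "\<sigma> \<in> partitions" "x \<in> G - dom B"
  shows "\<sigma> x \<le> up \<sigma> x" "dn \<sigma> x \<le> \<sigma> x" "up \<sigma> x \<le> int l" "0 \<le> dn \<sigma> x"
proof -
  show "\<sigma> x \<le> up \<sigma> x" "dn \<sigma> x \<le> \<sigma> x"
    using assms partitions_cov by (auto simp: le_up_iff dn_le_iff)
  obtain p k where x: "x = (p, k)" by fastforce
  then have pk: "p \<in> P" "k \<in> R p" "k \<noteq> Max (R p)" using assms interior_iff by blast+
  have u: "(x, (p, next_below (Rh p) k)) \<in> cov" using below_in_fiber(4) pk x by blast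
  have d: "((p, next_above (R p) k), x) \<in> cov" using above_in_fiber(4) pk x by blast
  show "up \<sigma> x \<le> int l" 
    using le_up_iff[OF assms(2), of "up \<sigma> x" \<sigma>] u partitions_range[OF assms(1)] cov_G[OF u] by fastforce
  show "0 \<le> dn \<sigma> x" 
    using dn_le_iff[OF assms(2), of \<sigma> "dn \<sigma> x"] d partitions_range[OF assms(1)] cov_G[OF d] by fastforce
qed

text \<open>Only the inequalities along covers at \<open>x\<close> are affected, and these are what
  the two bounds on \<open>c\<close> express. The toggle is one instance;
  \<open>label_change\<close> uses the full range of values.\<close>

lemma partitions_update:
  assumes \<sigma>: "\<sigma> \<in> partitions" and x: "x \<in> G - dom B" and c: "c \<le> up \<sigma> x" "dn \<sigma> x \<le> c"
  shows "\<sigma>(x := c) \<in> partitions"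
proof -
  have "0 \<le> c" "c \<le> int l" using up_bounds[OF \<sigma> x] c by auto
  then have ext: "\<sigma>(x := c) \<in> G \<rightarrow>\<^sub>E {0..int l}"
    using \<sigma> x unfolding Q_partitions_def by (auto simp: PiE_iff extensional_def split: if_splits)
  have "(\<sigma>(x := c)) y \<le> (\<sigma>(x := c)) z" if "(y, z) \<in> cov" for y z
    using that c[unfolded le_up_iff[OF x] dn_le_iff[OF x]] cov_snd[OF that] partitions_cov[OF \<sigma> that]
    by (cases "y = x"; cases "z = x") (simp_all del: split_paired_All)
  then have "monotone_on G (\<lambda>x y. (x, y) \<in> ord) (\<le>) (\<sigma>(x := c))"
    by (intro monotone_onI) (rule ord_mono[of "\<sigma>(x := c)"])
  then show ?thesis using ext \<sigma> x by (auto simp: Q_partitions_def)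
qed

lemma toggle_partition:
  assumes "\<sigma> \<in> partitions" "x \<in> G - dom B" shows "toggle ord x \<sigma> \<in> partitions"
  unfolding toggle_eq using up_bounds[OF assms] by (intro partitions_update assms) auto

lemma up_dn_cong:
  assumes "\<And>y. snd y \<noteq> snd x \<Longrightarrow> \<sigma> y = \<tau> y"
  shows "up \<sigma> x = up \<tau> x" "dn \<sigma> x = dn \<tau> x"
proof -
  have "\<sigma> ` {y. (x, y) \<in> cov} = \<tau> ` {y. (x, y) \<in> cov}"
    by (rule image_cong[OF refl]) (metis assms cov_snd mem_Collect_eq)
  then show "up \<sigma> x = up \<tau> x" by (simp add: up_def)
  have "\<sigma> ` {y. (y, x) \<in> cov} = \<tau> ` {y. (y, x) \<in> cov}"
    by (rule image_cong[OF refl]) (metis assms cov_snd mem_Collect_eq)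
  then show "dn \<sigma> x = dn \<tau> x" by (simp add: dn_def)
qed

lemma toggles_commute: "comp_fun_commute (\<lambda>p. toggle ord (p, k))"
proof (unfold_locales, rule ext)
  fix p q \<sigma>
  show "(toggle ord (q, k) \<circ> toggle ord (p, k)) \<sigma> = (toggle ord (p, k) \<circ> toggle ord (q, k)) \<sigma>"
  proof (cases "p = q")
    case False
    have "up (\<sigma>((a, k) := c)) (b, k) = up \<sigma> (b, k)" "dn (\<sigma>((a, k) := c)) (b, k) = dn \<sigma> (b, k)"
      for a b c by (rule up_dn_cong; auto)+
    then show ?thesis using False by (simp add: toggle_eq fun_upd_twist)
  qed simp
qed

text \<open>The bounds at level \<open>k\<close> depend on other levels only, so composing the
  toggles is the same as toggling all elements of the level at once with the bounds of the original
  \<sigma>.\<close>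

lemma fold_toggle:
  assumes "finite T"
  shows "Finite_Set.fold (\<lambda>p. toggle ord (p, k)) \<sigma> T =
    (\<lambda>x. if snd x = k \<and> fst x \<in> T then up \<sigma> x + dn \<sigma> x - \<sigma> x else \<sigma> x)"
  using assms
proof (induction T rule: finite_induct)
  case (insert p T)
  interpret comp_fun_commute "\<lambda>p. toggle ord (p, k)" by (rule toggles_commute)
  let ?\<tau> = "\<lambda>x. if snd x = k \<and> fst x \<in> T then up \<sigma> x + dn \<sigma> x - \<sigma> x else \<sigma> x"
  have "up ?\<tau> (p, k) = up \<sigma> (p, k)" "dn ?\<tau> (p, k) = dn \<sigma> (p, k)" by (rule up_dn_cong; auto)+
  then show ?case unfolding fold_insert[OF insert.hyps] insert.IH unfolding toggle_eq
    using insert.hyps by (intro ext) auto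
qed simp

lemma finite_level: "finite {p. (p, k) \<in> G - dom B}"
  by (rule finite_subset[OF _ finP]) (auto simp: mem_G)

lemma toggle_level_eq:
  "TL k \<sigma> (p, m) =
    (if m = k \<and> p \<in> P \<and> k \<in> R p \<and> k \<noteq> Max (R p) then up \<sigma> (p, k) + dn \<sigma> (p, k) - \<sigma> (p, k) else \<sigma> (p, m))"
  unfolding toggle_level_def fold_toggle[OF finite_level] using interior_iff[of p k] by auto

lemma toggle_level_partition:
  assumes \<sigma>: "\<sigma> \<in> partitions" shows "TL k \<sigma> \<in> partitions"
proof -
  interpret comp_fun_commute "\<lambda>p. toggle ord (p, k)" by (rule toggles_commute)
  have "Finite_Set.fold (\<lambda>p. toggle ord (p, k)) \<sigma> T \<in> partitions"
    if "finite T" "T \<subseteq> {p. (p, k) \<in> G - dom B}" for T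
    using that by (induction T rule: finite_induct) (use \<sigma> toggle_partition in auto)
  then show ?thesis using finite_level unfolding toggle_level_def by blast
qed

section \<open>Free labels and Bender-Knuth involutions in one fiber\<close>

lemma label_gt_iff:
  assumes f: "f \<in> labelings" and c: "(p, i) \<in> cells" and k: "k = lo p \<or> k \<in> R p"
  shows "k < f (p, i) \<longleftrightarrow> int l - \<Phi> f (p, k) < int i"
  using f_hat_gt_iff[OF f, of p k i] c k by (simp add: f_hat_cells mem_G mem_cells)

context
  fixes f p k
  assumes f: "f \<in> labelings" and p: "p \<in> P" and k: "k \<in> R p" "k \<noteq> Max (R p)"
begin

lemma interior: "(p, k) \<in> G - dom B"
  using interior_iff p k by blast

text \<open>An element of \<open>Rh p\<close> equals \<open>k\<close> iff it exceeds the predecessor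
  of \<open>k\<close> but not \<open>k\<close> itself, which gives two thresholds. The range of
  \<Phi> keeps the interval inside \<open>{1..l}\<close>.\<close>

lemma label_low_iff:
  "(p, i) \<in> cells \<and> f (p, i) = k \<longleftrightarrow>
    int l - \<Phi> f (p, next_below (Rh p) k) < int i \<and> int i \<le> int l - \<Phi> f (p, k)"
proof -
  note b = below_in_fiber[OF p k(1)]
  have G: "(p, k) \<in> G" "(p, next_below (Rh p) k) \<in> G" using p k b by (auto simp: mem_G)
  show ?thesis
  proof (cases "i \<in> {1..l}")
    case True
    note gt = f_hat_gt_iff[OF f G(1) True] f_hat_gt_iff[OF f G(2) True]
    have "fh f p i = k \<longleftrightarrow> next_below (Rh p) k < fh f p i \<and> \<not> k < fh f p i"
    proof -
      have "fh f p i = lo p \<or> fh f p i = hi p \<or> fh f p i \<in> R p"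
        using f_hat_Rh[OF f p True] by (auto simp: Rh_eq)
      moreover have "lo p \<le> next_below (Rh p) k" using b(2) lo_less[OF p p] by force
      ultimately show ?thesis
        using b(1) b(3)[of "fh f p i"] lo_less[OF p p k(1)] less_hi[OF p p k(1)] by linarith
    qed
    moreover have "(p, i) \<in> cells \<and> f (p, i) = k \<longleftrightarrow> fh f p i = k"
      using f_hat_R_iff[OF f p True] k f_hat_cells by auto
    ultimately show ?thesis using gt by auto
  next
    case False
    then show ?thesis using Phi_range[OF G(1), of f] Phi_range[OF G(2), of f] by (auto simp: mem_cells)
  qed
qed

lemma label_high_iff:
  "(p, i) \<in> cells \<and> f (p, i) = next_above (R p) k \<longleftrightarrow>
    int l - \<Phi> f (p, k) < int i \<and> int i \<le> int l - \<Phi> f (p, next_above (R p) k)"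
proof -
  note a = above_in_fiber[OF p k]
  have G: "(p, k) \<in> G" "(p, next_above (R p) k) \<in> G" using p k a by (auto simp: mem_G)
  show ?thesis
  proof (cases "i \<in> {1..l}")
    case True
    note gt = f_hat_gt_iff[OF f G(1) True] f_hat_gt_iff[OF f G(2) True]
    have "fh f p i = next_above (R p) k \<longleftrightarrow> k < fh f p i \<and> \<not> next_above (R p) k < fh f p i"
    proof -
      have "fh f p i = lo p \<or> fh f p i = hi p \<or> fh f p i \<in> R p"
        using f_hat_Rh[OF f p True] by (auto simp: Rh_eq)
      then show ?thesis
        using a(1) a(3)[of "fh f p i"] lo_less[OF p p k(1)] less_hi[OF p p a(2)] by linarith
    qed
    moreover have "(p, i) \<in> cells \<and> f (p, i) = next_above (R p) k \<longleftrightarrow> fh f p i = next_above (R p) k"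
      using f_hat_R_iff[OF f p True] a f_hat_cells by auto
    ultimately show ?thesis using gt by auto
  next
    case False
    then show ?thesis using Phi_range[OF G(1), of f] Phi_range[OF G(2), of f] by (auto simp: mem_cells)
  qed
qed

text \<open>Surjectivity of \<Phi> realises the new value and injectivity on each fiber confines the
  change to \<open>p\<close>. This supplies the witnesses for raisable and lowerable labels.\<close>

lemma label_change:
  assumes "c \<le> up (\<Phi> f) (p, k)" "dn (\<Phi> f) (p, k) \<le> c"
  obtains g where "g \<in> labelings" "\<Phi> g = (\<Phi> f)((p, k) := c)"
    "\<forall>(q, j)\<in>cells. q \<noteq> p \<longrightarrow> g (q, j) = f (q, j)"
proof -
  obtain g where g: "g \<in> labelings" "\<Phi> g = (\<Phi> f)((p, k) := c)"
    using Phi_surj[OF partitions_update[OF Phi_partition[OF f] interior assms]] by blast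
  have "g (q, j) = f (q, j)" if "(q, j) \<in> cells" "q \<noteq> p" for q j
    by (rule Phi_fiber_inj[OF g(1) f _ that(1)]) (use g(2) that in auto)
  then show thesis using that g by blast
qed

lemma Phi_other_fiber:
  assumes "g \<in> labelings" "\<forall>(q, j)\<in>cells. q \<noteq> p \<longrightarrow> g (q, j) = f (q, j)" "(q, m) \<in> G" "q \<noteq> p"
  shows "\<Phi> g (q, m) = \<Phi> f (q, m)"
proof -
  have q: "q \<in> P" using assms by (simp add: mem_G)
  have "fh g q i = fh f q i" if "i \<in> {1..l}" for i
    using assms(2,4) q by - (cases rule: position_cases[OF q that], auto simp: f_hat_lo f_hat_hi f_hat_cells)
  then have "{i \<in> {1..l}. m < fh g q i} = {i \<in> {1..l}. m < fh f q i}" by auto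
  then show ?thesis using assms(3) by (simp add: Phi_eq)
qed

lemma free_low_iff:
  "i \<in> free_low P r l u v R k f p \<longleftrightarrow>
    int l - up (\<Phi> f) (p, k) < int i \<and> int i \<le> int l - \<Phi> f (p, k)" (is "?L \<longleftrightarrow> ?A")
proof
  note b = below_in_fiber[OF p k(1)]
  note s = up_bounds[OF Phi_partition[OF f] interior]
  have U: "up (\<Phi> f) (p, k) \<le> \<Phi> f (p, next_below (Rh p) k)"
    using le_up_iff[OF interior, of "up (\<Phi> f) (p, k)" "\<Phi> f"] b(4) by auto
  { assume ?L
    then obtain g where c: "(p, i) \<in> cells" "f (p, i) = k" and g: "g \<in> labelings" "k < g (p, i)"
      "\<forall>(q, j)\<in>cells. q \<noteq> p \<longrightarrow> g (q, j) = f (q, j)"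
      by (auto simp: free_low_def raisable_def)
    note low = label_low_iff[of i]
    have gi: "int l - \<Phi> g (p, k) < int i" using label_gt_iff[OF g(1) c(1)] g(2) k by auto
    \<comment> \<open>In the fiber of \<open>p\<close>, the label \<open>k\<close> at
      \<open>i\<close> already exceeds the smaller label of \<open>y\<close>. In any other fiber
      \<open>g\<close> has the values of \<open>f\<close>, and monotonicity of
      \<open>\<Phi> g\<close> passes on the threshold that \<open>g\<close> satisfies at
      \<open>(p, k)\<close>.\<close>
    have "int l - int i + 1 \<le> \<Phi> f y" if y: "((p, k), y) \<in> cov" for y
    proof (cases "fst y = p")
      case True
      then have "y = (p, snd y)" by auto
      then have "snd y < k" using gamma_covers_same(1)[OF restriction_Rh, of p k "snd y" r] y by metis
      moreover have "(p, snd y) \<in> G" using cov_G[OF y] \<open>y = (p, snd y)\<close> by metis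
      ultimately show ?thesis
        using label_gt_iff[OF f c(1), of "snd y"] c(2) \<open>y = (p, snd y)\<close> mem_G[of p "snd y"] by auto
    next
      case False
      then have "\<Phi> g y = \<Phi> f y" using Phi_other_fiber[OF g(1,3)] cov_G[OF y] by (cases y) auto
      then show ?thesis using Phi_cov[OF g(1) y] gi by simp
    qed
    then have "int l - int i + 1 \<le> up (\<Phi> f) (p, k)" by (simp add: le_up_iff[OF interior])
    then show ?A using low c by auto }
  assume A: ?A
  have c: "(p, i) \<in> cells" "f (p, i) = k" using label_low_iff[of i] A U by auto
  \<comment> \<open>The value \<open>l - i + 1\<close> is the least one at \<open>(p, k)\<close>
    that makes the label at \<open>i\<close> exceed \<open>k\<close>.\<close>
  obtain g where g: "g \<in> labelings" "\<Phi> g = (\<Phi> f)((p, k) := int l - int i + 1)"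
    "\<forall>(q, j)\<in>cells. q \<noteq> p \<longrightarrow> g (q, j) = f (q, j)"
    using label_change[of "int l - int i + 1"] A s by auto
  have "k < g (p, i)" using label_gt_iff[OF g(1) c(1), of k] k g(2) by simp
  then show ?L using c g by (auto simp: free_low_def raisable_def)
qed

lemma free_high_iff:
  "i \<in> free_high P r l u v R k f p \<longleftrightarrow>
    int l - \<Phi> f (p, k) < int i \<and> int i \<le> int l - dn (\<Phi> f) (p, k)" (is "?L \<longleftrightarrow> ?A")
proof
  note a = above_in_fiber[OF p k]
  note s = up_bounds[OF Phi_partition[OF f] interior]
  have D: "\<Phi> f (p, next_above (R p) k) \<le> dn (\<Phi> f) (p, k)"
    using dn_le_iff[OF interior, of "\<Phi> f" "dn (\<Phi> f) (p, k)"] a(4) by auto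
  { assume ?L
    then obtain g where c: "(p, i) \<in> cells" "f (p, i) = next_above (R p) k"
      and g: "g \<in> labelings" "g (p, i) < next_above (R p) k"
      "\<forall>(q, j)\<in>cells. q \<noteq> p \<longrightarrow> g (q, j) = f (q, j)"
      by (auto simp: free_high_def lowerable_def)
    note high = label_high_iff[of i]
    have "\<not> k < g (p, i)" using a(3)[OF labelings_R[OF g(1) c(1)]] g(2) by auto
    then have gi: "int i \<le> int l - \<Phi> g (p, k)" using label_gt_iff[OF g(1) c(1)] k by auto
    \<comment> \<open>The only lower cover in the fiber of \<open>p\<close> belongs to the next
      label, which the label at \<open>i\<close> does not exceed. In other fibers
      \<open>\<Phi> g\<close> agrees with \<open>\<Phi> f\<close> and is bounded by its value at
      \<open>(p, k)\<close>.\<close>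
    have "\<Phi> f z \<le> int l - int i" if z: "(z, (p, k)) \<in> cov" for z
    proof (cases "fst z = p")
      case True
      then have zz: "z = (p, snd z)" by auto
      have "(p, snd z) \<in> G" using cov_G[OF z] zz by metis
      have "k < snd z" "next_above (R p) k \<in> Rh p \<Longrightarrow> k < next_above (R p) k \<Longrightarrow> snd z \<le> next_above (R p) k"
        using gamma_covers_same[OF restriction_Rh, of p "snd z" k r] z zz by metis+
      then have "k < snd z" "next_above (R p) k \<ge> snd z" using a by (auto simp: Rh_eq)
      then have "snd z \<in> R p" using \<open>(p, snd z) \<in> G\<close> lo_less[OF p p k(1)] by (auto simp: mem_G)
      then have "snd z = next_above (R p) k"
        using a(3) \<open>k < snd z\<close> \<open>next_above (R p) k \<ge> snd z\<close> by force
      then show ?thesis using high c zz by (metis le_diff_eq add.commute)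
    next
      case False
      then have "\<Phi> g z = \<Phi> f z" using Phi_other_fiber[OF g(1,3)] cov_G[OF z] by (cases z) auto
      then show ?thesis using Phi_cov[OF g(1) z] gi by simp
    qed
    then have "dn (\<Phi> f) (p, k) \<le> int l - int i" by (simp add: dn_le_iff[OF interior])
    then show ?A using high c by auto }
  assume A: ?A
  have c: "(p, i) \<in> cells" "f (p, i) = next_above (R p) k" using label_high_iff[of i] A D by auto
  \<comment> \<open>The value \<open>l - i\<close> is the greatest one at \<open>(p, k)\<close> for
    which the label at \<open>i\<close> does not exceed \<open>k\<close>.\<close>
  obtain g where g: "g \<in> labelings" "\<Phi> g = (\<Phi> f)((p, k) := int l - int i)"
    "\<forall>(q, j)\<in>cells. q \<noteq> p \<longrightarrow> g (q, j) = f (q, j)"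
    using label_change[of "int l - int i"] A s by auto
  have "\<not> k < g (p, i)" using label_gt_iff[OF g(1) c(1), of k] k g(2) by simp
  then have "g (p, i) < next_above (R p) k" using a by linarith
  then show ?L using c g by (auto simp: free_high_def lowerable_def)
qed

text \<open>The free positions form the interval \<open>{x<..z}\<close>, in which \<open>f\<close>
  switches from \<open>k\<close> to the next label after \<open>y\<close>. Swapping the
  multiplicities moves the switch to \<open>x + z - y\<close>, which is the threshold belonging to
  the toggled value.\<close>

lemma bender_knuth_fiber:
  assumes g: "g \<in> labelings" and eq: "\<Phi> g = TL k (\<Phi> f)" and c: "(p, i) \<in> cells"
  shows "BK k f (p, i) = g (p, i)"
proof -
  note s = up_bounds[OF Phi_partition[OF f] interior]
  note a = above_in_fiber[OF p k]
  note b = below_in_fiber[OF p k(1)]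
  let ?lo = "free_low P r l u v R k f p" and ?hi = "free_high P r l u v R k f p"
  define x where "x = nat (int l - up (\<Phi> f) (p, k))"
  define y where "y = nat (int l - \<Phi> f (p, k))"
  define z where "z = nat (int l - dn (\<Phi> f) (p, k))"
  have xyz: "int x = int l - up (\<Phi> f) (p, k)" "int y = int l - \<Phi> f (p, k)"
    "int z = int l - dn (\<Phi> f) (p, k)" "x \<le> y" "y \<le> z"
    using s by (auto simp: x_def y_def z_def)
  have lo_set: "?lo = {x<..y}" and hi_set: "?hi = {y<..z}"
    using free_low_iff free_high_iff xyz by auto
  have free: "?lo \<union> ?hi = {x<..z}" using xyz by (auto simp: lo_set hi_set)
  have gk: "\<Phi> g (p, k) = up (\<Phi> f) (p, k) + dn (\<Phi> f) (p, k) - \<Phi> f (p, k)"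
    and gm: "\<And>m. m \<noteq> k \<Longrightarrow> \<Phi> g (p, m) = \<Phi> f (p, m)"
    using eq p k by (auto simp: toggle_level_eq)
  have g_gt: "k < g (p, i) \<longleftrightarrow> x + z < i + y"
    using label_gt_iff[OF g c, of k] k gk xyz by auto
  have f_gt: "k < f (p, i) \<longleftrightarrow> y < i" using label_gt_iff[OF f c, of k] k xyz by auto
  \<comment> \<open>In this fiber the toggle alters only the threshold of \<open>k\<close>, so
    \<open>f\<close> and \<open>g\<close> can differ only in how they compare with
    \<open>k\<close>.\<close>
  have m_iff: "m < g (p, i) \<longleftrightarrow> m < f (p, i)" if "m = lo p \<or> m \<in> R p" "m \<noteq> k" for m
    using label_gt_iff[OF g c that(1)] label_gt_iff[OF f c that(1)] gm[OF that(2)] by simp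
  have gR: "g (p, i) \<in> R p" and fR: "f (p, i) \<in> R p" using labelings_R f g c by auto
  have bk: "BK k f (p, i) = (if i \<notin> {x<..z} then f (p, i)
      else if card {j \<in> {x<..z}. j < i} < z - y then k else next_above (R p) k)"
  proof -
    have "BK k f (p, i) = (if i \<notin> ?lo \<union> ?hi then f (p, i)
        else if card {j \<in> ?lo \<union> ?hi. j < i} < card ?hi then k else next_above (R p) k)"
      using c k by (simp add: bender_knuth_def Let_def)
    moreover have "card ?hi = z - y" by (simp add: hi_set)
    ultimately show ?thesis unfolding free by simp
  qed
  show ?thesis
  proof (cases "i \<in> {x<..z}")
    case False
    \<comment> \<open>Both switching points \<open>y\<close> and \<open>x + z - y\<close> lie
      between \<open>x\<close> and \<open>z\<close>, so outside the free interval they decide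
      alike.\<close>
    then have "k < g (p, i) \<longleftrightarrow> k < f (p, i)" using g_gt f_gt xyz by auto
    then have "m < g (p, i) \<longleftrightarrow> m < f (p, i)" if "m \<in> R p" for m using m_iff that by blast
    from this[OF gR] this[OF fR] have "f (p, i) = g (p, i)" by auto
    then show ?thesis using bk False by simp
  next
    case True
    have "{j \<in> {x<..z}. j < i} = {x<..<i}" using True by auto
    then have "card {j \<in> {x<..z}. j < i} = i - Suc x" by simp
    \<comment> \<open>There are \<open>i - Suc x\<close> free positions before \<open>i\<close>, so
      \<open>i\<close> is among the first \<open>z - y\<close> exactly up to the new switching
      point.\<close>
    moreover have "i - Suc x < z - y \<longleftrightarrow> \<not> x + z < i + y" using True \<open>y \<le> z\<close> by auto
    ultimately have crd: "card {j \<in> {x<..z}. j < i} < z - y \<longleftrightarrow> \<not> k < g (p, i)"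
      using g_gt by simp
    have f_cases: "f (p, i) = k \<or> f (p, i) = next_above (R p) k"
      using True free unfolding free_low_def free_high_def by blast
    \<comment> \<open>The unchanged comparisons with the two neighbouring labels leave only
      \<open>k\<close> and its successor for \<open>g (p, i)\<close>.\<close>
    have "next_below (Rh p) k < g (p, i)" using m_iff[OF b(2)] b(1) f_cases a(1) by auto
    moreover have "\<not> next_above (R p) k < g (p, i)"
      using m_iff[of "next_above (R p) k"] a f_cases by auto
    ultimately have "g (p, i) = (if k < g (p, i) then next_above (R p) k else k)"
      using a(3)[OF gR] b(3)[OF gR] by auto
    then show ?thesis using bk True crd by auto
  qed
qed

end

text \<open>Take the labeling \<open>g\<close> whose image is the toggled partition and compare it
  with \<open>BK k f\<close> fiber by fiber; that \<open>BK k f\<close> is again a labeling then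
  comes with the equality. Fibers fixed by \<open>BK\<close> are those where no toggle at level
  \<open>k\<close> acts.\<close>

lemma Phi_bender_knuth:
  assumes f: "f \<in> labelings"
  shows "BK k f \<in> labelings" "\<Phi> (BK k f) = TL k (\<Phi> f)"
proof -
  obtain g where g: "g \<in> labelings" "\<Phi> g = TL k (\<Phi> f)"
    using Phi_surj[OF toggle_level_partition[OF Phi_partition[OF f]]] by blast
  have "BK k f = g"
  proof
    fix x :: "'a \<times> nat"
    obtain p i where x: "x = (p, i)" by fastforce
    show "BK k f x = g x"
    proof (cases "x \<in> cells")
      case False
      then show ?thesis using g(1)
        by (simp add: x bender_knuth_def strict_labelings_def PiE_def extensional_def)
    next
      case True
      then have c: "(p, i) \<in> cells" "p \<in> P" by (auto simp: x mem_cells)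
      show ?thesis
      proof (cases "k \<in> R p \<and> k \<noteq> Max (R p)")
        case True
        then show ?thesis using bender_knuth_fiber[OF f c(2) _ _ g c(1)] x by blast
      next
        case False
        then have "f (p, i) = g (p, i)"
          by (intro Phi_fiber_inj[OF f g(1) _ c(1)]) (auto simp: g(2) toggle_level_eq)
        then show ?thesis using False c x by (auto simp: bender_knuth_def)
      qed
    qed
  qed
  then show "BK k f \<in> labelings" "\<Phi> (BK k f) = TL k (\<Phi> f)" using g by auto
qed

section \<open>Promotion as a finite composition\<close>

lemma bender_knuth_trivial:
  assumes f: "f \<in> labelings" and k: "\<And>p. p \<in> P \<Longrightarrow> k \<notin> R p"
  shows "BK k f = f"
proof
  fix x
  show "BK k f x = f x"
    using f k by (cases x)
      (auto simp: bender_knuth_def strict_labelings_def PiE_def extensional_def mem_cells restrict_def)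
qed

lemma fold_bender_knuth:
  assumes "f \<in> labelings"
  shows "fold BK ks f \<in> labelings \<and> \<Phi> (fold BK ks f) = fold TL ks (\<Phi> f)"
  using assms by (induction ks arbitrary: f) (auto simp: Phi_bender_knuth)

lemma fold_bender_knuth_trivial:
  assumes "f \<in> labelings" and "\<And>k p. k \<in> set ks \<Longrightarrow> p \<in> P \<Longrightarrow> k \<notin> R p"
  shows "fold BK ks f = f"
  using assms by (induction ks) (auto simp: bender_knuth_trivial)

text \<open>Beyond a common bound on the absolute values of all labels every \<open>BK k\<close>
  fixes all labelings, so lengthening the list of indices at either end changes nothing.\<close>

lemma promotion_stable:
  assumes f: "f \<in> labelings"
  obtains y where "y \<in> labelings" "\<forall>\<^sub>F N in sequentially. fold BK [- int N..int N] f = y"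
proof -
  have "finite (\<Union>p\<in>P. R p)" using finP finR by auto
  then have "finite (abs ` (\<Union>p\<in>P. R p))" by blast
  then obtain M where M: "\<And>k. k \<in> abs ` (\<Union>p\<in>P. R p) \<Longrightarrow> k \<le> M"
    using bdd_above_finite bdd_above.E by metis
  define n where "n = nat M"
  have out: "k \<notin> R p" if "p \<in> P" "k < - int n \<or> int n < k" for k p
  proof
    assume "k \<in> R p"
    then have "\<bar>k\<bar> \<le> M" using M that by blast
    moreover have "M \<le> int n" by (simp add: n_def)
    ultimately show False using that by arith
  qed
  have "fold BK [- int N..int N] f = fold BK [- int n..int n] f" if "n \<le> N" for N
  proof -
    have "[- int N..int N] = [- int N..- int n - 1] @ [- int n..int N]"
      using upto_split1[of "- int N" "- int n" "int N"] that by simp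
    also have "[- int n..int N] = [- int n..int n] @ [int n + 1..int N]"
      using upto_split2[of "- int n" "int n" "int N"] that by simp
    finally have split: "[- int N..int N] = [- int N..- int n - 1] @ [- int n..int n] @ [int n + 1..int N]" .
    have "fold BK [- int N..- int n - 1] f = f"
      by (rule fold_bender_knuth_trivial[OF f]) (use out in auto)
    moreover have "fold BK [int n + 1..int N] g = g" if "g \<in> labelings" for g
      by (rule fold_bender_knuth_trivial[OF that]) (use out in auto)
    ultimately show ?thesis using fold_bender_knuth[OF f] by (simp add: split)
  qed
  then have "\<forall>\<^sub>F N in sequentially. fold BK [- int N..int N] f = fold BK [- int n..int n] f"
    by (rule eventually_sequentiallyI)
  then show thesis using that fold_bender_knuth[OF f] by blast
qed

lemma Phi_promotion:
  assumes f: "f \<in> labelings"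
  shows "\<Phi> (promotion P r l u v R f) = toggle_promotion P r l u v R (\<Phi> f)"
proof -
  obtain y where y: "\<forall>\<^sub>F N in sequentially. fold BK [- int N..int N] f = y"
    using promotion_stable[OF f] by blast
  \<comment> \<open>Each finite composition of toggle levels is the \<Phi>-image of the
    corresponding one of Bender-Knuth involutions, so stabilisation carries over.\<close>
  then have "\<forall>\<^sub>F N in sequentially. fold TL [- int N..int N] (\<Phi> f) = \<Phi> y"
    by eventually_elim (use fold_bender_knuth[OF f] in metis)
  then show ?thesis
    using int_composition_eqI[OF y] int_composition_eqI[of TL "\<Phi> f" "\<Phi> y"]
    by (simp add: promotion_def toggle_promotion_def)
qed

end

theorem theorem2p8:
  fixes P :: "'a set" and r :: "'a rel" and l :: nat
    and u v :: "'a \<Rightarrow> nat" and R :: "'a \<Rightarrow> int set"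
  assumes "finite P" and "partial_order_on P r"
    and "l > 0"
    and "\<And>p. p \<in> P \<Longrightarrow> u p + v p \<le> l"
    and "\<And>p q. (p, q) \<in> r \<Longrightarrow> v p \<le> v q"
    and "\<And>p q. (p, q) \<in> r \<Longrightarrow> u p \<ge> u q"
    and "restriction_function P R"
    and "consistent P r l u v R"
  shows "bij_betw (Phi P r l u v R) (strict_labelings P r l u v R)
           (Q_partitions (gamma P (R_hat P r R)) (gamma_order P r (R_hat P r R)) l
              (B_hat P r l u v R)) \<and>
         (\<forall>f\<in>strict_labelings P r l u v R.
            Phi P r l u v R (promotion P r l u v R f) =
            toggle_promotion P r l u v R (Phi P r l u v R f))"
proof -
  interpret labeling_data P r l u v R by unfold_locales (fact assms)+
  show ?thesis using Phi_bij Phi_promotion by blast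
qed

end
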